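(* Assume $h_0\equiv0$ on $\Omega$. Let $\eta_0>0$, $\eta_1\in\mathbb{R}$ and let $\eta$ be the solution of $\eta''=G(\eta,\eta')$, $\eta(0)=\eta_0$, $\eta'(0)=\eta_1$ on its maximal interval of existence $[0,T[$. Then $T=+\infty$; there exist $M_0,M_1>0$ such that $0<\eta(t)\le M_0$ and $|\eta'(t)|\le M_1$ for all $t\ge0$; $\eta(t)\to0$ as $t\to+\infty$; and there exist $t_0\ge0$, $a>0$ and $b\in\mathbb{R}$ with $t_0+b>0$ such that $\eta(t)\ge a/\sqrt{t+b}$ for all $t\ge t_0$. Moreover, there is no $\bar\eta>0$ with $G(\bar\eta,0)=0$ (no stationary solution).
   Context: Let $\Omega\subset\mathbb{R}^2$ be a bounded open set with regular boundary, $0\in\Omega$. Let $F>0$, $K=\{\varphi\in H^1_0(\Omega):\varphi\ge 0\}$. With $h_0\equiv 0$, for $\beta>0$, $\gamma\in\mathbb{R}$, let $q\in K$ be the unique solution of $\int_\Omega (h_0+\beta)^3\nabla q\cdot\nabla(\varphi-q)\ge \int_\Omega h_0\,\partial_{x_1}(\varphi-q)-\gamma\int_\Omega(\varphi-q)$ for all $\varphi\in K$, and set $G(\beta,\gamma)=\int_\Omega q\,dx-F$. *)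

theory Defs
  imports "HOL-Analysis.Analysis"
begin

type_synonym pt = "real ^ 2"

definition C1c :: "pt set \<Rightarrow> (pt \<Rightarrow> real) \<Rightarrow> (pt \<Rightarrow> pt) \<Rightarrow> bool" where
  "C1c \<Omega> \<psi> d \<longleftrightarrow>
     (\<forall>x. (\<psi> has_derivative (\<lambda>h. d x \<bullet> h)) (at x)) \<and> continuous_on UNIV d \<and>
     (\<exists>K. compact K \<and> K \<subseteq> \<Omega> \<and> (\<forall>x. x \<notin> K \<longrightarrow> \<psi> x = 0))"

text \<open>H^1_0(Omega): closure of C^1_c(Omega) in the H^1 norm. An element is represented by
  a function u together with its (weak) gradient g.\<close>
definition H10 :: "pt set \<Rightarrow> (pt \<Rightarrow> real) \<Rightarrow> (pt \<Rightarrow> pt) \<Rightarrow> bool" where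
  "H10 \<Omega> u g \<longleftrightarrow>
     u \<in> borel_measurable lborel \<and> g \<in> borel_measurable lborel \<and>
     integrable lborel (\<lambda>x. (u x)\<^sup>2) \<and> integrable lborel (\<lambda>x. (norm (g x))\<^sup>2) \<and>
     (\<exists>\<psi> d. (\<forall>n. C1c \<Omega> (\<psi> n) (d n)) \<and>
        (\<lambda>n. (\<integral>x. (\<psi> n x - u x)\<^sup>2 \<partial>lborel)) \<longlonglongrightarrow> 0 \<and>
        (\<lambda>n. (\<integral>x. (norm (d n x - g x))\<^sup>2 \<partial>lborel)) \<longlonglongrightarrow> 0)"

definition inK :: "pt set \<Rightarrow> (pt \<Rightarrow> real) \<Rightarrow> (pt \<Rightarrow> pt) \<Rightarrow> bool" where
  "inK \<Omega> u g \<longleftrightarrow> H10 \<Omega> u g \<and> (AE x in lborel. u x \<ge> 0)"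

definition vi_sol :: "pt set \<Rightarrow> (pt \<Rightarrow> real) \<Rightarrow> real \<Rightarrow> real \<Rightarrow> (pt \<Rightarrow> real) \<Rightarrow> (pt \<Rightarrow> pt) \<Rightarrow> bool" where
  "vi_sol \<Omega> h0 \<beta> \<gamma> q gq \<longleftrightarrow> inK \<Omega> q gq \<and>
     (\<forall>\<phi> g\<phi>. inK \<Omega> \<phi> g\<phi> \<longrightarrow>
        (LINT x:\<Omega>|lborel. (h0 x + \<beta>) ^ 3 * (gq x \<bullet> (g\<phi> x - gq x)))
        \<ge> (LINT x:\<Omega>|lborel. h0 x * ((g\<phi> x - gq x) $ 1))
           - \<gamma> * (LINT x:\<Omega>|lborel. \<phi> x - q x))"

text \<open>G(beta,gamma) = int_Omega q - F, with h0 = 0 (q unique, so the integral is well defined).\<close>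
definition Gfun :: "pt set \<Rightarrow> real \<Rightarrow> real \<Rightarrow> real \<Rightarrow> real" where
  "Gfun \<Omega> F \<beta> \<gamma> = (THE v. \<exists>q gq. vi_sol \<Omega> (\<lambda>_. 0) \<beta> \<gamma> q gq \<and> v = (LINT x:\<Omega>|lborel. q x) - F)"

definition regular_boundary :: "pt set \<Rightarrow> bool" where
  "regular_boundary \<Omega> \<longleftrightarrow> (\<forall>x\<in>frontier \<Omega>. \<exists>r>0. \<exists>(R :: pt \<Rightarrow> pt) (\<phi> :: real \<Rightarrow> real) \<phi>'.
      orthogonal_transformation R \<and>
      (\<forall>s. (\<phi> has_real_derivative \<phi>' s) (at s)) \<and> continuous_on UNIV \<phi>' \<and>
      \<Omega> \<inter> ball x r = {y \<in> ball x r. (R (y - x)) $ 2 < \<phi> ((R (y - x)) $ 1)})"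

text \<open>eta (with derivative deta) solves eta'' = G(eta, eta'), eta(0)=eta0, eta'(0)=eta1,
  staying in the domain eta > 0 of G, on [0,T[.\<close>
definition ode_sol :: "(real \<Rightarrow> real \<Rightarrow> real) \<Rightarrow> real \<Rightarrow> real \<Rightarrow> ereal \<Rightarrow> (real \<Rightarrow> real) \<Rightarrow> (real \<Rightarrow> real) \<Rightarrow> bool" where
  "ode_sol G e0 e1 T \<eta> d\<eta> \<longleftrightarrow> T > 0 \<and> \<eta> 0 = e0 \<and> d\<eta> 0 = e1 \<and>
     (\<forall>t. 0 \<le> t \<and> ereal t < T \<longrightarrow>
        \<eta> t > 0 \<and>
        (\<eta> has_real_derivative d\<eta> t) (at t within {s. 0 \<le> s \<and> ereal s < T}) \<and>
        (d\<eta> has_real_derivative G (\<eta> t) (d\<eta> t)) (at t within {s. 0 \<le> s \<and> ereal s < T}))"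

definition maximal_ode_sol :: "(real \<Rightarrow> real \<Rightarrow> real) \<Rightarrow> real \<Rightarrow> real \<Rightarrow> ereal \<Rightarrow> (real \<Rightarrow> real) \<Rightarrow> (real \<Rightarrow> real) \<Rightarrow> bool" where
  "maximal_ode_sol G e0 e1 T \<eta> d\<eta> \<longleftrightarrow> ode_sol G e0 e1 T \<eta> d\<eta> \<and>
     \<not> (\<exists>T' \<zeta> d\<zeta>. T' > T \<and> ode_sol G e0 e1 T' \<zeta> d\<zeta> \<and>
          (\<forall>t. 0 \<le> t \<and> ereal t < T \<longrightarrow> \<zeta> t = \<eta> t))"

end

theory Submission
  imports Defs
begin

text \<open>
  With \<open>h\<^sub>0 = 0\<close> the obstacle problem is linear on the cone \<open>K\<close>: \<open>q = 0\<close> if \<open>\<gamma> \<ge> 0\<close>, and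
  \<open>q = (- \<gamma> / \<beta>\<^sup>3) w\<close> if \<open>\<gamma> < 0\<close>, where \<open>w\<close> minimises \<open>\<integral> \<bar>\<nabla>u\<bar>\<^sup>2 / 2 - \<integral> u\<close> over \<open>K\<close>. Hence
  \<open>G(\<beta>, \<gamma>) = A \<gamma>\<^sup>- / \<beta>\<^sup>3 - F\<close> with \<open>A = \<integral> w > 0\<close>, and \<open>G(\<beta>, 0) = - F < 0\<close>.

  For \<open>\<eta>'' = A (\<eta>')\<^sup>- / \<eta>\<^sup>3 - F\<close> the quantity \<open>\<Phi> = \<eta>' - A / (2 \<eta>\<^sup>2) + F t\<close> is nondecreasing, and it is
  constant once \<open>\<eta>' \<le> 0\<close>, which happens after a finite time and persists. Since \<open>\<eta>'\<close> is bounded,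
  \<open>A / (2 \<eta>\<^sup>2) = \<eta>' + F t - \<Phi>\<close> grows exactly linearly, which gives the lower bound, global
  existence and the convergence to \<open>0\<close>.
\<close>

text \<open>\<open>Gfun\<close> is a definite description, so its closed form needs a solution of
  the inequality and uniqueness of the integral of solutions. The energy is uniformly convex in the
  gradient, so minimising sequences converge strongly: completeness of L2 and the Poincare
  inequality replace weak compactness, and the sign constraint passes to the limit along a
  subsequence converging almost everywhere.

  In the equation for \<open>\<eta>\<close> the right-hand side is singular at
  \<open>\<eta> = 0\<close> and has a kink at \<open>\<eta>' = 0\<close>. The kink is harmless,
  since the negative part is Lipschitz. Elementary barriers bound \<open>\<eta>\<close> from above
  and \<open>\<eta>'\<close> from both sides, so the only conceivable breakdown in finite time is
  \<open>\<eta>\<close> reaching 0; the monotone quantity \<open>\<Phi>\<close> excludes it.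
  Maximality only says that no longer solution extends the given one, so a finite \<open>T\<close>
  is refuted by building such a solution: extend continuously to \<open>T\<close>, restart there,
  glue.\<close>

text \<open>Squaring removes the corner of the positive part: the difference quotient misses
  \<open>2 * max 0 s\<close> by at most \<open>\<bar>h\<bar>\<close>, whatever the signs of
  \<open>s\<close> and \<open>s + h\<close>. This gives both a C1 bump function and the barrier
  principle for differential inequalities.\<close>

lemma DERIV_square_positive_part:
  "((\<lambda>s. (max 0 s)\<^sup>2) has_real_derivative 2 * max 0 s) (at (s::real))"
proof -
  have bd: "\<bar>((max 0 (s + h))\<^sup>2 - (max 0 s)\<^sup>2) / h - 2 * max 0 s\<bar> \<le> \<bar>h\<bar>" if "h \<noteq> 0" for h
  proof -
    have "\<bar>(max 0 (s + h))\<^sup>2 - (max 0 s)\<^sup>2 - 2 * max 0 s * h\<bar> \<le> h\<^sup>2"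
    proof (cases "0 \<le> s"; cases "0 \<le> s + h")
      assume "0 \<le> s" "\<not> 0 \<le> s + h"
      then have "s * s \<le> - (s * h)" "max 0 (s + h) = 0" "max 0 s = s"
        using mult_left_mono[of s "- h" s] by auto
      moreover have "0 \<le> s * s" "0 \<le> h * h" "0 \<le> s * s + 2 * (s * h) + h * h"
        using zero_le_power2[of "s + h"] by (simp_all add: power2_eq_square algebra_simps)
      moreover have "(max 0 (s + h))\<^sup>2 - (max 0 s)\<^sup>2 - 2 * max 0 s * h = - (s * s) - 2 * (s * h)"
        using calculation(2,3) by (simp add: power2_eq_square)
      ultimately show ?thesis unfolding power2_eq_square by linarith
    next
      assume "\<not> 0 \<le> s" "0 \<le> s + h"
      then have "(s + h)\<^sup>2 \<le> h\<^sup>2" by (intro power_mono) auto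
      then show ?thesis using \<open>\<not> 0 \<le> s\<close> \<open>0 \<le> s + h\<close> by simp
    qed (auto simp: power2_sum)
    then have "\<bar>(max 0 (s + h))\<^sup>2 - (max 0 s)\<^sup>2 - 2 * max 0 s * h\<bar> / \<bar>h\<bar> \<le> h\<^sup>2 / \<bar>h\<bar>"
      by (intro divide_right_mono) auto
    also have "h\<^sup>2 / \<bar>h\<bar> = \<bar>h\<bar>" using that by (simp add: power2_eq_square abs_if)
    finally show ?thesis using that unfolding abs_divide[symmetric] by (simp add: diff_divide_distrib)
  qed
  have "(\<lambda>h. ((max 0 (s + h))\<^sup>2 - (max 0 s)\<^sup>2) / h - 2 * max 0 s) \<midarrow>0\<rightarrow> 0"
  proof (rule Lim_null_comparison)
    show "\<forall>\<^sub>F h in at 0. norm (((max 0 (s + h))\<^sup>2 - (max 0 s)\<^sup>2) / h - 2 * max 0 s) \<le> \<bar>h\<bar>"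
      using bd by (auto simp: eventually_at_filter)
    show "(\<lambda>h. \<bar>h\<bar>) \<midarrow>0\<rightarrow> (0::real)"
      by (rule tendsto_rabs_zero) simp
  qed
  then show ?thesis unfolding DERIV_def by (rule LIM_zero_cancel)
qed

subsection \<open>Square-integrable functions\<close>

text \<open>Values lie in a Euclidean space so that functions and gradients are treated
  alike.\<close>

definition L2 :: "'a measure \<Rightarrow> ('a \<Rightarrow> 'b::euclidean_space) \<Rightarrow> bool" where
  "L2 M f \<longleftrightarrow> f \<in> borel_measurable M \<and> integrable M (\<lambda>x. (norm (f x))\<^sup>2)"

text \<open>The squared L2 norm: expansions and the parallelogram law then need no square
  roots.\<close>

definition sqint :: "'a measure \<Rightarrow> ('a \<Rightarrow> 'b::euclidean_space) \<Rightarrow> real" where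
  "sqint M f = (\<integral>x. (norm (f x))\<^sup>2 \<partial>M)"

lemma L2_integrable_square: "L2 M f \<Longrightarrow> integrable M (\<lambda>x. (norm (f x))\<^sup>2)"
  by (simp add: L2_def)

lemma sqint_nonneg: "0 \<le> sqint M f"
  by (simp add: sqint_def)

lemma L2_integrable_inner:
  assumes "L2 M f" "L2 M g"
  shows "integrable M (\<lambda>x. f x \<bullet> g x)"
proof (rule Bochner_Integration.integrable_bound)
  show "integrable M (\<lambda>x. (norm (f x))\<^sup>2 + (norm (g x))\<^sup>2)"
    using assms by (auto simp: L2_def)
  show "(\<lambda>x. f x \<bullet> g x) \<in> borel_measurable M"
    using assms by (auto simp: L2_def)
  have "\<bar>f x \<bullet> g x\<bar> \<le> (norm (f x))\<^sup>2 + (norm (g x))\<^sup>2" for x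
  proof -
    have "\<bar>f x \<bullet> g x\<bar> \<le> norm (f x) * norm (g x)" by (rule Cauchy_Schwarz_ineq2)
    also have "\<dots> \<le> (norm (f x))\<^sup>2 + (norm (g x))\<^sup>2"
      using sum_squares_bound[of "norm (f x)" "norm (g x)"]
        mult_nonneg_nonneg[OF norm_ge_zero[of "f x"] norm_ge_zero[of "g x"]]
      unfolding mult.assoc by linarith
    finally show ?thesis .
  qed
  then show "AE x in M. norm (f x \<bullet> g x) \<le> norm ((norm (f x))\<^sup>2 + (norm (g x))\<^sup>2)"
    by simp
qed

lemma norm_add_square: "(norm (x + y))\<^sup>2 = (norm x)\<^sup>2 + 2 * (x \<bullet> y) + (norm (y::'a::real_inner))\<^sup>2"
  by (simp add: power2_norm_eq_inner inner_add inner_commute)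

lemma L2_scaleR: "L2 M f \<Longrightarrow> L2 M (\<lambda>x. c *\<^sub>R f x)"
  by (auto simp: L2_def power_mult_distrib)

lemma L2_add: assumes "L2 M f" "L2 M g" shows "L2 M (\<lambda>x. f x + g x)"
  using assms L2_integrable_inner[OF assms] by (auto simp: L2_def norm_add_square)

lemma L2_diff: assumes "L2 M f" "L2 M g" shows "L2 M (\<lambda>x. f x - g x)"
  using L2_add[OF assms(1) L2_scaleR[OF assms(2), of "-1"]] by simp

lemma sqint_scaleR: "sqint M (\<lambda>x. c *\<^sub>R f x) = c\<^sup>2 * sqint M f"
  by (simp add: sqint_def power_mult_distrib)

lemma sqint_minus_commute: "sqint M (\<lambda>x. f x - g x) = sqint M (\<lambda>x. g x - f x)"
  by (simp add: sqint_def norm_minus_commute)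

lemma sqint_add_eq:
  assumes "L2 M f" "L2 M g"
  shows "sqint M (\<lambda>x. f x + g x) = sqint M f + 2 * (\<integral>x. f x \<bullet> g x \<partial>M) + sqint M g"
  using assms L2_integrable_inner[OF assms]
  by (simp add: sqint_def norm_add_square L2_def)

lemma sqint_diff_eq:
  assumes "L2 M f" "L2 M g"
  shows "sqint M (\<lambda>x. f x - g x) = sqint M f - 2 * (\<integral>x. f x \<bullet> g x \<partial>M) + sqint M g"
  using sqint_add_eq[OF assms(1) L2_scaleR[OF assms(2), of "-1"]]
  by (simp add: sqint_def)

text \<open>The parallelogram law with one square dropped. It stands in for the triangle inequality
  wherever constants do not matter.\<close>

lemma sqint_add_le:
  assumes "L2 M f" "L2 M g"
  shows "sqint M (\<lambda>x. f x + g x) \<le> 2 * sqint M f + 2 * sqint M g"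
  using sqint_diff_eq[OF assms] sqint_add_eq[OF assms] sqint_nonneg[of M "\<lambda>x. f x - g x"] by linarith

lemma sqint_eq_0_iff:
  assumes "L2 M f"
  shows "sqint M f = 0 \<longleftrightarrow> (AE x in M. f x = 0)"
proof -
  have "sqint M f = 0 \<longleftrightarrow> (AE x in M. (norm (f x))\<^sup>2 = 0)"
    unfolding sqint_def using assms
    by (intro integral_nonneg_eq_0_iff_AE) (auto simp: L2_def)
  then show ?thesis by simp
qed

lemma L2_Cauchy_Schwarz:
  assumes "L2 M f" "L2 M g"
  shows "\<bar>\<integral>x. f x \<bullet> g x \<partial>M\<bar> \<le> sqrt (sqint M f) * sqrt (sqint M g)"
proof -
  define b where "b = (\<integral>x. f x \<bullet> g x \<partial>M)"
  have "b\<^sup>2 \<le> sqint M f * sqint M g"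
  proof (cases "sqint M g = 0")
    case True
    then have "AE x in M. g x = 0" using sqint_eq_0_iff assms by blast
    then have "AE x in M. f x \<bullet> g x = 0" by auto
    then have "b = 0" unfolding b_def by (rule integral_eq_zero_AE)
    then show ?thesis by (simp add: True)
  next
    case False
    then have pos: "sqint M g > 0" using sqint_nonneg[of M g] by linarith
    \<comment> \<open>The minimiser of the quadratic
      \<open>s \<mapsto> sqint M (\<lambda>x. f x - s *\<^sub>R g x)\<close>; its minimal value is
      nonnegative.\<close>
    let ?s = "b / sqint M g"
    have "0 \<le> sqint M (\<lambda>x. f x - ?s *\<^sub>R g x)" by (rule sqint_nonneg)
    also have "\<dots> = sqint M f - 2 * ?s * b + ?s\<^sup>2 * sqint M g"
      using sqint_diff_eq[OF assms(1) L2_scaleR[OF assms(2), of ?s]]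
      by (simp add: sqint_scaleR b_def)
    also have "\<dots> = sqint M f - b\<^sup>2 / sqint M g"
      using pos by (simp add: field_simps power2_eq_square)
    finally show ?thesis using pos by (simp add: field_simps)
  qed
  then have "sqrt (b\<^sup>2) \<le> sqrt (sqint M f * sqint M g)" by (rule real_sqrt_le_mono)
  then show ?thesis unfolding b_def[symmetric] by (simp only: real_sqrt_abs real_sqrt_mult)
qed

lemma L2_inner_tendsto_0:
  assumes f: "L2 M f" and h: "\<And>n. L2 M (h n)" and lim: "(\<lambda>n. sqint M (h n)) \<longlonglongrightarrow> 0"
  shows "(\<lambda>n. \<integral>x. f x \<bullet> h n x \<partial>M) \<longlonglongrightarrow> 0"
proof (rule Lim_null_comparison)
  show "\<forall>\<^sub>F n in sequentially. norm (\<integral>x. f x \<bullet> h n x \<partial>M) \<le> sqrt (sqint M f) * sqrt (sqint M (h n))"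
    using L2_Cauchy_Schwarz[OF f h] by simp
  show "(\<lambda>n. sqrt (sqint M f) * sqrt (sqint M (h n))) \<longlonglongrightarrow> 0"
    using tendsto_mult_right_zero[OF tendsto_real_sqrt[OF lim, simplified]] by simp
qed

section \<open>Fatou's lemma and completeness of L2\<close>

lemma L2_Fatou:
  fixes f :: "nat \<Rightarrow> 'a \<Rightarrow> 'b::euclidean_space"
  assumes f: "\<And>n. L2 M (f n)" and g: "g \<in> borel_measurable M"
    and lim: "AE x in M. (\<lambda>n. f n x) \<longlonglongrightarrow> g x"
    and bd: "eventually (\<lambda>n. sqint M (f n) \<le> C) sequentially"
  shows "L2 M g" "sqint M g \<le> C"
proof -
  have C: "0 \<le> C"
    using eventually_happens'[OF sequentially_bot bd] sqint_nonneg order_trans by blast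
  have [measurable]: "f n \<in> borel_measurable M" for n using f by (simp add: L2_def)
  note g[measurable]
  have eq: "(\<integral>\<^sup>+x. ennreal ((norm (f n x))\<^sup>2) \<partial>M) = ennreal (sqint M (f n))" for n
    unfolding sqint_def using f by (intro nn_integral_eq_integral) (auto simp: L2_def)
  have "(\<integral>\<^sup>+x. ennreal ((norm (g x))\<^sup>2) \<partial>M) = (\<integral>\<^sup>+x. liminf (\<lambda>n. ennreal ((norm (f n x))\<^sup>2)) \<partial>M)"
  proof (rule nn_integral_cong_AE, use lim in eventually_elim)
    case (elim x)
    have "(\<lambda>n. ennreal ((norm (f n x))\<^sup>2)) \<longlonglongrightarrow> ennreal ((norm (g x))\<^sup>2)"
      by (intro tendsto_intros elim)
    then show ?case
      by (metis lim_imp_Liminf trivial_limit_sequentially)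
  qed
  also have "\<dots> \<le> liminf (\<lambda>n. \<integral>\<^sup>+x. ennreal ((norm (f n x))\<^sup>2) \<partial>M)"
    by (intro nn_integral_liminf) measurable
  also have "\<dots> \<le> liminf (\<lambda>n. ennreal C)"
    unfolding eq
    by (intro Liminf_mono eventually_mono[OF bd]) (simp add: ennreal_leI)
  also have "\<dots> = ennreal C" by (simp add: Liminf_const)
  finally have le: "(\<integral>\<^sup>+x. ennreal ((norm (g x))\<^sup>2) \<partial>M) \<le> ennreal C" .
  have int: "integrable M (\<lambda>x. (norm (g x))\<^sup>2)"
    by (intro integrableI_bounded) (use le in \<open>auto simp: top_unique less_top[symmetric]\<close>)
  then show "L2 M g" by (simp add: L2_def)
  have "ennreal (sqint M g) \<le> ennreal C"
    using le nn_integral_eq_integral[OF int] by (simp add: sqint_def)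
  then show "sqint M g \<le> C" using C by (simp add: ennreal_le_iff)
qed

text \<open>Young's inequality with weight \<open>2 ^ k\<close>: \<open>2 * a k\<close> is at most
  \<open>2 ^ k * (a k)\<^sup>2 + (1/2) ^ k\<close>. It turns square-integral bounds on increments
  into pointwise absolute summability.\<close>

lemma summable_if_weighted_squares_summable:
  fixes a :: "nat \<Rightarrow> real"
  assumes nn: "\<And>k. 0 \<le> a k" and s: "summable (\<lambda>k. 2 ^ k * (a k)\<^sup>2)"
  shows "summable a"
proof (rule summable_comparison_test')
  show "summable (\<lambda>k. 2 ^ k * (a k)\<^sup>2 + (1/2) ^ k)"
    by (intro summable_add s summable_geometric) simp
  fix k :: nat
  have "2 * (a k) \<le> 2 ^ k * (a k)\<^sup>2 + (1/2) ^ k"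
  proof -
    have "0 \<le> 2 ^ k * (a k - (1/2) ^ k)\<^sup>2" by simp
    also have "\<dots> = 2 ^ k * (a k)\<^sup>2 - 2 * a k * (2 ^ k * (1/2) ^ k) + (2 ^ k * (1/2) ^ k) * (1/2) ^ k"
      by (simp add: power2_eq_square algebra_simps)
    also have "2 ^ k * (1/2) ^ k = (1::real)" by (simp add: power_one_over)
    finally show ?thesis by simp
  qed
  then show "norm (a k) \<le> 2 ^ k * (a k)\<^sup>2 + (1/2) ^ k" using nn[of k] by simp
qed

text \<open>Riesz-Fischer. Along a subsequence whose increments have squared norm below
  \<open>(1/4) ^ k\<close>, the weight \<open>2 ^ k\<close> still leaves a geometric series, so the
  telescoping sum converges almost everywhere. The subsequence is part of the conclusion because
  nonnegativity of a limit is read off pointwise.\<close>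

lemma L2_complete:
  fixes f :: "nat \<Rightarrow> 'a \<Rightarrow> 'b::euclidean_space"
  assumes f: "\<And>n. L2 M (f n)"
    and cauchy: "\<And>e. e > 0 \<Longrightarrow> \<exists>N. \<forall>m\<ge>N. \<forall>n\<ge>N. sqint M (\<lambda>x. f m x - f n x) < e"
  obtains g r where "L2 M g" "(\<lambda>n. sqint M (\<lambda>x. f n x - g x)) \<longlonglongrightarrow> 0"
    "strict_mono r" "AE x in M. (\<lambda>n. f (r n) x) \<longlonglongrightarrow> g x"
proof -
  have [measurable]: "f n \<in> borel_measurable M" for n using f by (simp add: L2_def)
  have "\<exists>r. strict_mono r \<and> (\<forall>k m. r k \<le> m \<longrightarrow> sqint M (\<lambda>x. f m x - f (r k) x) < (1/4) ^ k)"
  proof -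
    obtain N where N: "\<And>k m n. m \<ge> N k \<Longrightarrow> n \<ge> N k \<Longrightarrow> sqint M (\<lambda>x. f m x - f n x) < (1/4) ^ k"
      using cauchy[of "(1/4) ^ _"] by (metis zero_less_divide_1_iff zero_less_numeral zero_less_power)
    define r where "r = rec_nat (N 0) (\<lambda>k a. max (Suc a) (N (Suc k)))"
    have "r k < r (Suc k)" for k by (auto simp: r_def)
    then have "strict_mono r" by (simp add: strict_mono_Suc_iff)
    moreover have "N k \<le> r k" for k by (cases k) (auto simp: r_def)
    ultimately show ?thesis using N by (meson order_trans)
  qed
  then obtain r where r: "strict_mono r"
    and rk: "\<And>k m. r k \<le> m \<Longrightarrow> sqint M (\<lambda>x. f m x - f (r k) x) < (1/4) ^ k" by blast
  define D where "D k x = norm (f (r (Suc k)) x - f (r k) x)" for k x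
  have [measurable]: "D k \<in> borel_measurable M" for k unfolding D_def by measurable
  have Dint: "(\<integral>\<^sup>+x. ennreal (2 ^ k * (D k x)\<^sup>2) \<partial>M) \<le> ennreal ((1/2) ^ k)" for k
  proof -
    have i: "integrable M (\<lambda>x. (D k x)\<^sup>2)"
      using L2_diff[OF f f] unfolding D_def L2_def by blast
    have "(\<integral>\<^sup>+x. ennreal (2 ^ k * (D k x)\<^sup>2) \<partial>M) = ennreal (\<integral>x. 2 ^ k * (D k x)\<^sup>2 \<partial>M)"
      by (intro nn_integral_eq_integral) (use i in auto)
    also have "(\<integral>x. 2 ^ k * (D k x)\<^sup>2 \<partial>M) = 2 ^ k * sqint M (\<lambda>x. f (r (Suc k)) x - f (r k) x)"
      by (simp add: D_def sqint_def)
    also have "\<dots> \<le> 2 ^ k * (1/4) ^ k"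
      using rk[of k "r (Suc k)"] r by (intro mult_left_mono) (auto simp: strict_mono_Suc_iff less_imp_le)
    also have "\<dots> = (1/2) ^ k" by (simp flip: power_mult_distrib)
    finally show ?thesis by (simp add: ennreal_leI)
  qed
  have "(\<integral>\<^sup>+x. (\<Sum>k. ennreal (2 ^ k * (D k x)\<^sup>2)) \<partial>M) = (\<Sum>k. \<integral>\<^sup>+x. ennreal (2 ^ k * (D k x)\<^sup>2) \<partial>M)"
    by (intro nn_integral_suminf) measurable
  also have "\<dots> \<le> (\<Sum>k. ennreal ((1/2) ^ k))"
    by (intro suminf_le Dint) auto
  also have "\<dots> = ennreal (\<Sum>k. (1/2) ^ k)"
    by (rule suminf_ennreal2) (simp_all add: summable_geometric)
  also have "\<dots> < \<infinity>" by simp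
  finally have fin: "(\<integral>\<^sup>+x. (\<Sum>k. ennreal (2 ^ k * (D k x)\<^sup>2)) \<partial>M) \<noteq> \<infinity>"
    by (rule less_imp_neq)
  have "AE x in M. (\<Sum>k. ennreal (2 ^ k * (D k x)\<^sup>2)) \<noteq> \<infinity>"
    by (intro nn_integral_PInf_AE fin) measurable
  then have conv: "AE x in M. convergent (\<lambda>k. f (r k) x)"
  proof eventually_elim
    case (elim x)
    have "summable (\<lambda>k. 2 ^ k * (D k x)\<^sup>2)"
      by (rule summable_suminf_not_top) (use elim in auto)
    then have "summable (\<lambda>k. D k x)"
      by (rule summable_if_weighted_squares_summable[rotated]) (simp add: D_def)
    then have "summable (\<lambda>k. f (r (Suc k)) x - f (r k) x)"
      unfolding D_def by (rule summable_norm_cancel)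
    then have "(\<lambda>n. \<Sum>k<n. f (r (Suc k)) x - f (r k) x) \<longlonglongrightarrow> (\<Sum>k. f (r (Suc k)) x - f (r k) x)"
      by (rule summable_LIMSEQ)
    then have "(\<lambda>n. f (r n) x - f (r 0) x) \<longlonglongrightarrow> (\<Sum>k. f (r (Suc k)) x - f (r k) x)"
      unfolding sum_lessThan_telescope[of "\<lambda>k. f (r k) x"] .
    then have "(\<lambda>n. (f (r n) x - f (r 0) x) + f (r 0) x) \<longlonglongrightarrow> (\<Sum>k. f (r (Suc k)) x - f (r k) x) + f (r 0) x"
      by (intro tendsto_intros)
    then show ?case by (auto simp: convergent_def)
  qed
  \<comment> \<open>By \<open>conv\<close> the points where this limit does not exist form a null
    set, so the value of \<open>lim\<close> there is immaterial.\<close>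
  define g where "g x = lim (\<lambda>k. f (r k) x)" for x
  have [measurable]: "g \<in> borel_measurable M"
    unfolding g_def by (rule borel_measurable_lim_metric) measurable
  have lim: "AE x in M. (\<lambda>n. f (r n) x) \<longlonglongrightarrow> g x"
    using conv by eventually_elim (simp add: g_def convergent_LIMSEQ_iff)
  \<comment> \<open>Fatou along the subsequence with \<open>m\<close> fixed yields square
    integrability of the difference and the error estimate at once; membership of \<open>g\<close>
    itself follows by adding \<open>f N\<close>.\<close>
  have diff: "L2 M (\<lambda>x. g x - f m x) \<and> sqint M (\<lambda>x. g x - f m x) \<le> e"
    if N: "\<And>m n. m \<ge> N \<Longrightarrow> n \<ge> N \<Longrightarrow> sqint M (\<lambda>x. f m x - f n x) < e" and "m \<ge> N" for e N m
  proof -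
    have "eventually (\<lambda>n. sqint M (\<lambda>x. f (r n) x - f m x) \<le> e) sequentially"
      using N[OF _ \<open>m \<ge> N\<close>] seq_suble[OF r]
      by (intro eventually_sequentiallyI[of N]) (meson less_imp_le order_trans)
    moreover have "AE x in M. (\<lambda>n. f (r n) x - f m x) \<longlonglongrightarrow> g x - f m x"
      using lim by eventually_elim (intro tendsto_intros)
    ultimately show ?thesis
      using L2_Fatou[of M "\<lambda>n x. f (r n) x - f m x" "\<lambda>x. g x - f m x" e] f
      by (auto intro: L2_diff)
  qed
  obtain N where "\<And>m n. m \<ge> N \<Longrightarrow> n \<ge> N \<Longrightarrow> sqint M (\<lambda>x. f m x - f n x) < 1"
    using cauchy[of 1] by auto
  then have "L2 M (\<lambda>x. g x - f N x)" using diff by blast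
  from L2_add[OF this f[of N]] have g: "L2 M g" by simp
  have "(\<lambda>n. sqint M (\<lambda>x. f n x - g x)) \<longlonglongrightarrow> 0"
  proof (rule LIMSEQ_I)
    fix e :: real assume "e > 0"
    then obtain N where N: "\<And>m n. m \<ge> N \<Longrightarrow> n \<ge> N \<Longrightarrow> sqint M (\<lambda>x. f m x - f n x) < e / 2"
      using cauchy[of "e/2"] by auto
    show "\<exists>no. \<forall>n\<ge>no. norm (sqint M (\<lambda>x. f n x - g x) - 0) < e"
    proof (intro exI allI impI)
      fix n assume "n \<ge> N"
      then have "sqint M (\<lambda>x. g x - f n x) \<le> e / 2" using diff[OF N] by blast
      then show "norm (sqint M (\<lambda>x. f n x - g x) - 0) < e"
        using \<open>e > 0\<close> sqint_nonneg[of M "\<lambda>x. f n x - g x"]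
          sqint_minus_commute[of M "f n" g] by simp
    qed
  qed
  with g lim r that show ?thesis by blast
qed

text \<open>Off \<open>S\<close> the difference \<open>f n - g\<close> is just \<open>- g\<close>,
  so the part of \<open>g\<close> off \<open>S\<close> has squared norm below every term of a null
  sequence.\<close>

lemma L2_limit_eq_0_outside:
  assumes f: "\<And>n. L2 M (f n)" and g: "L2 M g"
    and lim: "(\<lambda>n. sqint M (\<lambda>x. f n x - g x)) \<longlonglongrightarrow> 0"
    and S: "S \<in> sets M" and out: "\<And>n x. x \<notin> S \<Longrightarrow> f n x = 0"
  shows "AE x in M. x \<notin> S \<longrightarrow> g x = 0"
proof -
  have [measurable]: "g \<in> borel_measurable M" using g by (simp add: L2_def)
  note S[measurable]
  let ?h = "\<lambda>x. indicator (space M - S) x *\<^sub>R g x"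
  have h: "L2 M ?h"
    unfolding L2_def
  proof
    show "?h \<in> borel_measurable M" by measurable
    show "integrable M (\<lambda>x. (norm (?h x))\<^sup>2)"
      by (rule Bochner_Integration.integrable_bound[OF L2_integrable_square[OF g]])
        (auto simp: indicator_def)
  qed
  have "sqint M ?h \<le> sqint M (\<lambda>x. f n x - g x)" for n
    unfolding sqint_def
    by (intro integral_mono L2_integrable_square h L2_diff f g)
      (auto simp: indicator_def out)
  then have "sqint M ?h \<le> 0"
    using LIMSEQ_le_const[OF lim] by blast
  then have "AE x in M. ?h x = 0"
    using sqint_eq_0_iff[OF h] sqint_nonneg[of M ?h] by linarith
  then show ?thesis
    using AE_space by eventually_elim (auto simp: indicator_def split: if_splits)
qed

subsection \<open>The space \<open>H\<^sup>1\<^sub>0\<close>\<close>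

lemma C1cD:
  assumes "C1c \<Omega> \<psi> d"
  shows "(\<psi> has_derivative (\<lambda>h. d x \<bullet> h)) (at x)" and "continuous_on UNIV d"
    and "continuous_on UNIV \<psi>"
  using assms unfolding C1c_def
  by (auto simp: continuous_on_eq_continuous_at intro: has_derivative_continuous)

text \<open>The complement of \<open>K\<close> is open and \<open>\<psi>\<close> is constant there,
  so the gradient vanishes on it too.\<close>

lemma C1c_support:
  assumes "C1c \<Omega> \<psi> d"
  obtains K where "compact K" "K \<subseteq> \<Omega>" "\<And>x. x \<notin> K \<Longrightarrow> \<psi> x = 0" "\<And>x. x \<notin> K \<Longrightarrow> d x = 0"
proof -
  obtain K where K: "compact K" "K \<subseteq> \<Omega>" "\<And>x. x \<notin> K \<Longrightarrow> \<psi> x = 0"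
    using assms by (auto simp: C1c_def)
  have "d x = 0" if "x \<notin> K" for x
  proof -
    have "((\<lambda>_. 0) has_derivative (\<lambda>h. d x \<bullet> h)) (at x)"
      by (rule has_derivative_transform_within_open[OF C1cD(1)[OF assms], of "- K"])
        (use K that in \<open>auto intro: compact_imp_closed\<close>)
    then have "(\<lambda>h. d x \<bullet> h) = (\<lambda>h. 0)"
      by (rule has_derivative_unique) (rule has_derivative_const)
    then have "d x \<bullet> d x = 0" by metis
    then show ?thesis by simp
  qed
  with K that show ?thesis by blast
qed

lemma integrable_continuous_compact_support:
  fixes f :: "'a::euclidean_space \<Rightarrow> 'b::{banach, second_countable_topology}"
  assumes "continuous_on UNIV f" "compact K" "\<And>x. x \<notin> K \<Longrightarrow> f x = 0"
  shows "integrable lborel f"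
proof -
  have "integrable lborel (\<lambda>x. indicator K x *\<^sub>R f x)"
    using assms by (intro borel_integrable_compact) (auto intro: continuous_on_subset)
  moreover have "(\<lambda>x. indicator K x *\<^sub>R f x) = f"
    using assms(3) by (auto simp: indicator_def)
  ultimately show ?thesis by simp
qed

lemma C1c_L2:
  assumes "C1c \<Omega> \<psi> d"
  shows "L2 lborel \<psi>" "L2 lborel d"
proof -
  obtain K where K: "compact K" "\<And>x. x \<notin> K \<Longrightarrow> \<psi> x = 0" "\<And>x. x \<notin> K \<Longrightarrow> d x = 0"
    using C1c_support[OF assms] by metis
  have c: "continuous_on UNIV \<psi>" "continuous_on UNIV d" using C1cD[OF assms] by auto
  show "L2 lborel \<psi>" unfolding L2_def
    using K c by (auto intro!: borel_measurable_continuous_onI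
        integrable_continuous_compact_support[of _ K] continuous_intros)
  show "L2 lborel d" unfolding L2_def
    using K c by (auto intro!: borel_measurable_continuous_onI
        integrable_continuous_compact_support[of _ K] continuous_intros)
qed

text \<open>Translation invariance makes the integral of every difference quotient vanish.\<close>
lemma integral_directional_derivative_eq_0:
  assumes C: "C1c \<Omega> \<psi> d"
  shows "(\<integral>x. d x \<bullet> e \<partial>lborel) = 0"
proof -
  obtain K where K: "compact K" "\<And>x. x \<notin> K \<Longrightarrow> \<psi> x = 0" "\<And>x. x \<notin> K \<Longrightarrow> d x = 0"
    using C1c_support[OF C] by metis
  note der = C1cD(1)[OF C] and dcont = C1cD(2)[OF C] and cont = C1cD(3)[OF C]
  obtain R0 where R0: "K \<subseteq> cball 0 R0"
    using compact_imp_bounded[OF K(1)] by (auto simp: bounded_iff subset_iff)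
  have "bounded (d ` K)"
    using K(1) dcont by (intro compact_imp_bounded compact_continuous_image) (auto intro: continuous_on_subset)
  then obtain B where B0: "\<And>x. x \<in> K \<Longrightarrow> norm (d x) \<le> B" and "B > 0"
    by (auto simp: bounded_pos)
  then have B: "norm (d x) \<le> B" for x by (cases "x \<in> K") (auto simp: K)
  \<comment> \<open>As \<open>t n \<le> 1\<close>, a point outside this larger ball has both itself
    and its translate outside \<open>K\<close>. Hence all quotients share one bounded support, as
    dominated convergence requires.\<close>
  define R where "R = R0 + norm e"
  define t where "t n = inverse (real (Suc n))" for n
  have t: "t n > 0" "t n \<le> 1" for n by (auto simp: t_def field_simps)
  define q where "q n x = (\<psi> (x + t n *\<^sub>R e) - \<psi> x) / t n" for n x
  have int\<psi>: "integrable lborel \<psi>"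
    by (rule integrable_continuous_compact_support[OF cont K(1,2)])
  have [measurable]: "\<psi> \<in> borel_measurable borel" "d \<in> borel_measurable borel"
    using cont dcont by (auto intro: borel_measurable_continuous_onI)
  have q0: "(\<integral>x. q n x \<partial>lborel) = 0" for n
  proof -
    let ?s = "\<lambda>x. t n *\<^sub>R e + x"
    have "integrable (distr lborel borel ?s) \<psi>" using int\<psi> by (simp add: lborel_distr_plus)
    then have i: "integrable lborel (\<lambda>x. \<psi> (?s x))" by (subst (asm) integrable_distr_eq) auto
    have "(\<integral>x. \<psi> x \<partial>lborel) = (\<integral>x. \<psi> x \<partial>distr lborel borel ?s)" by (simp add: lborel_distr_plus)
    also have "\<dots> = (\<integral>x. \<psi> (?s x) \<partial>lborel)" by (subst integral_distr) auto
    finally have "(\<integral>x. \<psi> (?s x) - \<psi> x \<partial>lborel) = 0" using i int\<psi> by simp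
    then show ?thesis by (simp add: q_def add.commute)
  qed
  have qlim: "(\<lambda>n. q n x) \<longlonglongrightarrow> d x \<bullet> e" for x
  proof -
    have "((\<lambda>s. \<psi> (x + s *\<^sub>R e)) has_derivative (\<lambda>h. d x \<bullet> (h *\<^sub>R e))) (at 0)"
      using der[of x] by (intro has_derivative_compose[of "\<lambda>s. x + s *\<^sub>R e"  _ 0 UNIV \<psi>, simplified])
        (auto intro!: derivative_eq_intros)
    then have "((\<lambda>s. \<psi> (x + s *\<^sub>R e)) has_real_derivative (d x \<bullet> e)) (at 0)"
      by (simp add: has_field_derivative_def mult_commute_abs)
    then have "(\<lambda>s. (\<psi> (x + s *\<^sub>R e) - \<psi> x) / s) \<midarrow>0\<rightarrow> d x \<bullet> e"
      by (simp add: DERIV_def)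
    moreover have "filterlim t (at 0) sequentially"
      unfolding filterlim_at t_def[abs_def] using LIMSEQ_inverse_real_of_nat by auto
    ultimately show ?thesis unfolding q_def by (rule filterlim_compose)
  qed
  have qbd: "norm (q n x) \<le> indicator (cball 0 R) x * (B * norm e)" for n x
  proof (cases "x \<in> cball 0 R")
    case True
    have "norm (\<psi> (x + t n *\<^sub>R e) - \<psi> x) \<le> B * norm (x + t n *\<^sub>R e - x)"
    proof (rule differentiable_bound[of UNIV])
      show "onorm (\<lambda>h. d y \<bullet> h) \<le> B" for y
      proof (rule onorm_le)
        show "norm (d y \<bullet> h) \<le> B * norm h" for h
          using Cauchy_Schwarz_ineq2[of "d y" h] mult_right_mono[OF B[of y] norm_ge_zero[of h]] by simp
      qed
    qed (use der in auto)
    then show ?thesis using t[of n] True by (simp add: q_def field_simps)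
  next
    case False
    then have "norm x > R0 + norm e" by (simp add: R_def)
    moreover have "norm x \<le> norm (x + t n *\<^sub>R e) + norm e"
    proof -
      have "norm x \<le> norm (x + t n *\<^sub>R e) + norm (t n *\<^sub>R e)"
        by (metis add_diff_cancel_right' norm_triangle_ineq4)
      also have "norm (t n *\<^sub>R e) \<le> norm e" using t[of n] by (simp add: mult_left_le_one_le)
      finally show ?thesis by simp
    qed
    ultimately have "R0 < norm x" "R0 < norm (x + t n *\<^sub>R e)"
      using norm_ge_zero[of e] by linarith+
    then have "x \<notin> K" "x + t n *\<^sub>R e \<notin> K"
      using R0 by (auto simp: subset_iff)
    then show ?thesis using False by (simp add: q_def K)
  qed
  have "(\<lambda>n. \<integral>x. q n x \<partial>lborel) \<longlonglongrightarrow> (\<integral>x. d x \<bullet> e \<partial>lborel)"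
  proof (rule integral_dominated_convergence)
    show "integrable lborel (\<lambda>x. indicator (cball 0 R) x * (B * norm e))"
      by (intro integrable_mult_left integrable_real_indicator)
        (use emeasure_bounded_finite[OF bounded_cball, of 0 R] in auto)
    show "q n \<in> borel_measurable lborel" for n unfolding q_def by measurable
  qed (use qlim qbd in auto)
  then show ?thesis by (simp add: q0 LIMSEQ_const_iff)
qed

section \<open>The Poincare inequality for test functions\<close>

text \<open>Integration by parts against the coordinate \<open>x \<bullet> e\<close>: the derivative
  along \<open>e\<close> of \<open>(x \<bullet> e) * (\<psi> x)\<^sup>2\<close>, whose gradient is
  \<open>D\<close>, integrates to zero. This expresses the integral of \<open>\<psi>\<^sup>2\<close>
  through a product of \<open>\<psi>\<close> and its derivative, and Young's inequality absorbs
  \<open>\<psi>\<close>.\<close>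

lemma Poincare_C1c:
  assumes C: "C1c \<Omega> \<psi> d" and R: "\<Omega> \<subseteq> cball 0 R"
  shows "sqint lborel \<psi> \<le> 4 * R\<^sup>2 * sqint lborel d"
proof -
  obtain K where K: "compact K" "K \<subseteq> \<Omega>" "\<And>x. x \<notin> K \<Longrightarrow> \<psi> x = 0" "\<And>x. x \<notin> K \<Longrightarrow> d x = 0"
    using C1c_support[OF C] by metis
  define e where "e = (axis 1 1 :: pt)"
  have e: "norm e = 1" "e \<bullet> e = 1" by (auto simp: e_def norm_axis_1 inner_axis_axis)
  define D where "D x = (\<psi> x)\<^sup>2 *\<^sub>R e + (2 * (x \<bullet> e) * \<psi> x) *\<^sub>R d x" for x
  note der = C1cD(1)[OF C] and dcont = C1cD(2)[OF C] and cont = C1cD(3)[OF C]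
  have "C1c \<Omega> (\<lambda>x. (x \<bullet> e) * (\<psi> x)\<^sup>2) D"
    unfolding C1c_def
  proof (intro conjI allI exI[of _ K])
    fix x
    have "((\<lambda>x. (x \<bullet> e) * (\<psi> x)\<^sup>2) has_derivative
        (\<lambda>h. (x \<bullet> e) * (2 * \<psi> x * (d x \<bullet> h)) + (h \<bullet> e) * (\<psi> x)\<^sup>2)) (at x)"
      using der[of x] by (auto intro!: derivative_eq_intros simp: algebra_simps)
    then show "((\<lambda>x. (x \<bullet> e) * (\<psi> x)\<^sup>2) has_derivative (\<lambda>h. D x \<bullet> h)) (at x)"
      by (simp add: D_def inner_add_left inner_commute algebra_simps)
    show "continuous_on UNIV D"
      unfolding D_def by (intro continuous_intros dcont cont)
  qed (use K in auto)
  then have 0: "(\<integral>x. D x \<bullet> e \<partial>lborel) = 0" by (rule integral_directional_derivative_eq_0)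
  \<comment> \<open>Expanding the square of
    \<open>\<psi> x + 2 * (x \<bullet> e) * (d x \<bullet> e)\<close> gives this bound with constant
    \<open>4 * R\<^sup>2\<close>; the last term has integral zero.\<close>
  have pw: "(norm (\<psi> x))\<^sup>2 \<le> 4 * R\<^sup>2 * (norm (d x))\<^sup>2 + 2 * (D x \<bullet> e)" for x
  proof (cases "x \<in> K")
    case True
    then have xR: "norm x \<le> R" using K(2) R by auto
    have "\<bar>(x \<bullet> e) * (d x \<bullet> e)\<bar> \<le> R * norm (d x)"
      using Cauchy_Schwarz_ineq2[of x e] Cauchy_Schwarz_ineq2[of "d x" e] xR e
      by (auto simp: abs_mult intro!: mult_mono order_trans[OF _ xR])
    then have "((x \<bullet> e) * (d x \<bullet> e))\<^sup>2 \<le> (R * norm (d x))\<^sup>2"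
      using abs_le_square_iff by (metis abs_of_nonneg abs_ge_zero order_trans)
    moreover have "- ((2 * (x \<bullet> e) * (d x \<bullet> e)) * \<psi> x * 2) \<le> (\<psi> x)\<^sup>2 + (2 * (x \<bullet> e) * (d x \<bullet> e))\<^sup>2"
      using zero_le_power2[of "\<psi> x + 2 * (x \<bullet> e) * (d x \<bullet> e)"]
      by (simp add: power2_sum algebra_simps)
    ultimately have "- ((2 * (x \<bullet> e) * (d x \<bullet> e)) * \<psi> x * 2) \<le> (\<psi> x)\<^sup>2 + 4 * R\<^sup>2 * (norm (d x))\<^sup>2"
      by (simp add: power_mult_distrib)
    then show ?thesis
      by (simp add: D_def inner_add_left e algebra_simps)
  qed (simp add: D_def K)
  have iD: "integrable lborel (\<lambda>x. D x \<bullet> e)"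
    by (rule integrable_continuous_compact_support[of _ K])
      (use K in \<open>auto simp: D_def intro!: continuous_intros dcont cont\<close>)
  note i = L2_integrable_square[OF C1c_L2(1)[OF C]] L2_integrable_square[OF C1c_L2(2)[OF C]]
  have "sqint lborel \<psi> \<le> (\<integral>x. 4 * R\<^sup>2 * (norm (d x))\<^sup>2 + 2 * (D x \<bullet> e) \<partial>lborel)"
    unfolding sqint_def by (intro integral_mono pw) (use i iD in auto)
  also have "\<dots> = 4 * R\<^sup>2 * sqint lborel d"
    using i iD 0 by (simp add: sqint_def)
  finally show ?thesis .
qed

section \<open>Linear structure and closedness of \<open>H10\<close>\<close>

lemma C1c_zero: "C1c \<Omega> (\<lambda>_. 0) (\<lambda>_. 0)"
  by (auto simp: C1c_def intro!: exI[of _ "{}"])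

lemma C1c_add:
  assumes "C1c \<Omega> \<psi> d" "C1c \<Omega> \<phi> k"
  shows "C1c \<Omega> (\<lambda>x. \<psi> x + \<phi> x) (\<lambda>x. d x + k x)"
proof -
  obtain K where K: "compact K" "K \<subseteq> \<Omega>" "\<And>x. x \<notin> K \<Longrightarrow> \<psi> x = 0" using assms by (auto simp: C1c_def)
  obtain L where L: "compact L" "L \<subseteq> \<Omega>" "\<And>x. x \<notin> L \<Longrightarrow> \<phi> x = 0" using assms by (auto simp: C1c_def)
  have "\<psi> x + \<phi> x = 0" if "x \<notin> K \<union> L" for x using K L that by simp
  then show ?thesis unfolding C1c_def
    using C1cD[OF assms(1)] C1cD[OF assms(2)] K L
    by (intro conjI allI exI[of _ "K \<union> L"])
      (auto intro!: continuous_intros derivative_eq_intros simp: inner_add_left)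
qed

lemma C1c_scaleR:
  assumes "C1c \<Omega> \<psi> d"
  shows "C1c \<Omega> (\<lambda>x. c *\<^sub>R \<psi> x) (\<lambda>x. c *\<^sub>R d x)"
proof -
  obtain K where K: "compact K" "K \<subseteq> \<Omega>" "\<And>x. x \<notin> K \<Longrightarrow> \<psi> x = 0" using assms by (auto simp: C1c_def)
  show ?thesis unfolding C1c_def
    using C1cD[OF assms] K
    by (auto intro!: continuous_intros derivative_eq_intros exI[of _ "K"])
qed

lemma H10_iff:
  "H10 \<Omega> u g \<longleftrightarrow> L2 lborel u \<and> L2 lborel g \<and>
    (\<exists>\<psi> d. (\<forall>n. C1c \<Omega> (\<psi> n) (d n)) \<and> (\<lambda>n. sqint lborel (\<lambda>x. \<psi> n x - u x)) \<longlonglongrightarrow> 0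
      \<and> (\<lambda>n. sqint lborel (\<lambda>x. d n x - g x)) \<longlonglongrightarrow> 0)"
  by (simp add: H10_def L2_def sqint_def) blast

lemma H10_L2: "H10 \<Omega> u g \<Longrightarrow> L2 lborel u" "H10 \<Omega> u g \<Longrightarrow> L2 lborel g"
  by (simp_all add: H10_iff)

lemma H10_approx:
  assumes "H10 \<Omega> u g"
  obtains \<psi> d where "\<And>n. C1c \<Omega> (\<psi> n) (d n)"
    "(\<lambda>n. sqint lborel (\<lambda>x. \<psi> n x - u x)) \<longlonglongrightarrow> 0" "(\<lambda>n. sqint lborel (\<lambda>x. d n x - g x)) \<longlonglongrightarrow> 0"
  using assms unfolding H10_iff by blast

lemma C1c_imp_H10: "C1c \<Omega> \<psi> d \<Longrightarrow> H10 \<Omega> \<psi> d"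
  unfolding H10_iff using C1c_L2 by (auto simp: sqint_def intro!: exI[of _ "\<lambda>n. \<psi>"] exI[of _ "\<lambda>n. d"])

lemma sqint_add_tendsto_0:
  assumes "\<And>n. L2 M (f n)" "\<And>n. L2 M (g n)"
    and "(\<lambda>n. sqint M (f n)) \<longlonglongrightarrow> 0" "(\<lambda>n. sqint M (g n)) \<longlonglongrightarrow> 0"
  shows "(\<lambda>n. sqint M (\<lambda>x. f n x + g n x)) \<longlonglongrightarrow> 0"
proof (rule Lim_null_comparison)
  show "\<forall>\<^sub>F n in sequentially. norm (sqint M (\<lambda>x. f n x + g n x)) \<le> 2 * sqint M (f n) + 2 * sqint M (g n)"
    using sqint_add_le[OF assms(1,2)] by (auto simp: sqint_nonneg)
  show "(\<lambda>n. 2 * sqint M (f n) + 2 * sqint M (g n)) \<longlonglongrightarrow> 0"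
    by (rule tendsto_eq_intros assms refl | simp)+
qed

lemma H10_add:
  assumes "H10 \<Omega> u g" "H10 \<Omega> v k"
  shows "H10 \<Omega> (\<lambda>x. u x + v x) (\<lambda>x. g x + k x)"
proof -
  obtain \<psi> d where 1: "\<And>n. C1c \<Omega> (\<psi> n) (d n)"
    "(\<lambda>n. sqint lborel (\<lambda>x. \<psi> n x - u x)) \<longlonglongrightarrow> 0" "(\<lambda>n. sqint lborel (\<lambda>x. d n x - g x)) \<longlonglongrightarrow> 0"
    by (rule H10_approx[OF assms(1)]) blast
  obtain \<phi> l where 2: "\<And>n. C1c \<Omega> (\<phi> n) (l n)"
    "(\<lambda>n. sqint lborel (\<lambda>x. \<phi> n x - v x)) \<longlonglongrightarrow> 0" "(\<lambda>n. sqint lborel (\<lambda>x. l n x - k x)) \<longlonglongrightarrow> 0"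
    by (rule H10_approx[OF assms(2)]) blast
  note L = H10_L2[OF assms(1)] H10_L2[OF assms(2)] C1c_L2[OF 1(1)] C1c_L2[OF 2(1)]
  have "(\<lambda>n. sqint lborel (\<lambda>x. (\<psi> n x - u x) + (\<phi> n x - v x))) \<longlonglongrightarrow> 0"
    "(\<lambda>n. sqint lborel (\<lambda>x. (d n x - g x) + (l n x - k x))) \<longlonglongrightarrow> 0"
    by (intro sqint_add_tendsto_0 L2_diff L 1 2)+
  then show ?thesis unfolding H10_iff
    using C1c_add[OF 1(1) 2(1)]
    by (intro conjI L2_add L exI[of _ "\<lambda>n x. \<psi> n x + \<phi> n x"] exI[of _ "\<lambda>n x. d n x + l n x"])
      (simp_all add: algebra_simps)
qed

lemma H10_scaleR:
  assumes "H10 \<Omega> u g"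
  shows "H10 \<Omega> (\<lambda>x. c *\<^sub>R u x) (\<lambda>x. c *\<^sub>R g x)"
proof -
  obtain \<psi> d where 1: "\<And>n. C1c \<Omega> (\<psi> n) (d n)"
    "(\<lambda>n. sqint lborel (\<lambda>x. \<psi> n x - u x)) \<longlonglongrightarrow> 0" "(\<lambda>n. sqint lborel (\<lambda>x. d n x - g x)) \<longlonglongrightarrow> 0"
    by (rule H10_approx[OF assms(1)]) blast
  have "(\<lambda>n. sqint lborel (\<lambda>x. c *\<^sub>R (\<psi> n x - u x))) \<longlonglongrightarrow> 0"
    "(\<lambda>n. sqint lborel (\<lambda>x. c *\<^sub>R (d n x - g x))) \<longlonglongrightarrow> 0"
    unfolding sqint_scaleR by (intro tendsto_mult_right_zero 1)+
  then show ?thesis unfolding H10_iff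
    using C1c_scaleR[OF 1(1)]
    by (intro conjI L2_scaleR H10_L2[OF assms] exI[of _ "\<lambda>n x. c *\<^sub>R \<psi> n x"] exI[of _ "\<lambda>n x. c *\<^sub>R d n x"])
      (simp_all only: scaleR_diff_right simp_thms)
qed

lemma H10_diff:
  assumes "H10 \<Omega> u g" "H10 \<Omega> v k"
  shows "H10 \<Omega> (\<lambda>x. u x - v x) (\<lambda>x. g x - k x)"
  using H10_add[OF assms(1) H10_scaleR[OF assms(2), of "-1"]] by simp

lemma H10_AE_eq_0_outside:
  assumes "H10 \<Omega> u g" "open \<Omega>"
  shows "AE x in lborel. x \<notin> \<Omega> \<longrightarrow> u x = 0" "AE x in lborel. x \<notin> \<Omega> \<longrightarrow> g x = 0"
proof -
  obtain \<psi> d where 1: "\<And>n. C1c \<Omega> (\<psi> n) (d n)"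
    "(\<lambda>n. sqint lborel (\<lambda>x. \<psi> n x - u x)) \<longlonglongrightarrow> 0" "(\<lambda>n. sqint lborel (\<lambda>x. d n x - g x)) \<longlonglongrightarrow> 0"
    by (rule H10_approx[OF assms(1)]) blast
  have out: "\<psi> n x = 0 \<and> d n x = 0" if "x \<notin> \<Omega>" for n x
    using C1c_support[OF 1(1)[of n]] that by (metis subsetD)
  have S: "\<Omega> \<in> sets lborel" using assms(2) by simp
  show "AE x in lborel. x \<notin> \<Omega> \<longrightarrow> u x = 0"
    by (rule L2_limit_eq_0_outside[OF C1c_L2(1)[OF 1(1)] H10_L2(1)[OF assms(1)] 1(2) S]) (use out in auto)
  show "AE x in lborel. x \<notin> \<Omega> \<longrightarrow> g x = 0"
    by (rule L2_limit_eq_0_outside[OF C1c_L2(2)[OF 1(1)] H10_L2(2)[OF assms(1)] 1(3) S]) (use out in auto)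
qed

text \<open>The bound for test functions passes to limits. The constant 16 is the earlier 4 times
  two factors 2, one from comparing \<open>u\<close> with \<open>\<psi> n\<close> and one from
  comparing \<open>d n\<close> with \<open>g\<close>.\<close>

lemma Poincare_H10:
  assumes H: "H10 \<Omega> u g" and R: "\<Omega> \<subseteq> cball 0 R"
  shows "sqint lborel u \<le> 16 * R\<^sup>2 * sqint lborel g"
proof -
  obtain \<psi> d where 1: "\<And>n. C1c \<Omega> (\<psi> n) (d n)"
    "(\<lambda>n. sqint lborel (\<lambda>x. \<psi> n x - u x)) \<longlonglongrightarrow> 0" "(\<lambda>n. sqint lborel (\<lambda>x. d n x - g x)) \<longlonglongrightarrow> 0"
    by (rule H10_approx[OF H]) blast
  note L = H10_L2[OF H] C1c_L2[OF 1(1)]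
  have "sqint lborel u \<le> 16 * R\<^sup>2 * sqint lborel g
      + (16 * R\<^sup>2 * sqint lborel (\<lambda>x. d n x - g x) + 2 * sqint lborel (\<lambda>x. \<psi> n x - u x))" for n
  proof -
    have "sqint lborel u \<le> 2 * sqint lborel (\<psi> n) + 2 * sqint lborel (\<lambda>x. u x - \<psi> n x)"
      using sqint_add_le[OF L(3)[of n] L2_diff[OF L(1) L(3)[of n]]] by simp
    moreover have "sqint lborel (d n) \<le> 2 * sqint lborel g + 2 * sqint lborel (\<lambda>x. d n x - g x)"
      using sqint_add_le[OF L(2) L2_diff[OF L(4,2)], of n] by simp
    then have "4 * R\<^sup>2 * sqint lborel (d n) \<le> 4 * R\<^sup>2 * (2 * sqint lborel g + 2 * sqint lborel (\<lambda>x. d n x - g x))"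
      by (intro mult_left_mono) auto
    ultimately show ?thesis
      using Poincare_C1c[OF 1(1)[of n] R] sqint_minus_commute[of lborel u "\<psi> n"] by (simp add: algebra_simps)
  qed
  moreover have "(\<lambda>n. 16 * R\<^sup>2 * sqint lborel g
      + (16 * R\<^sup>2 * sqint lborel (\<lambda>x. d n x - g x) + 2 * sqint lborel (\<lambda>x. \<psi> n x - u x))) \<longlonglongrightarrow> 16 * R\<^sup>2 * sqint lborel g"
    by (rule tendsto_eq_intros 1 refl | simp)+
  ultimately show ?thesis by (intro LIMSEQ_le_const) auto
qed

text \<open>A diagonal choice: for each \<open>n\<close> one test function approximates
  \<open>u n\<close> and, with the same index, \<open>g n\<close> up to
  \<open>1 / (n + 1)\<close>.\<close>

lemma H10_closed:
  assumes H: "\<And>n. H10 \<Omega> (u n) (g n)" and L: "L2 lborel v" "L2 lborel k"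
    and lim: "(\<lambda>n. sqint lborel (\<lambda>x. u n x - v x)) \<longlonglongrightarrow> 0" "(\<lambda>n. sqint lborel (\<lambda>x. g n x - k x)) \<longlonglongrightarrow> 0"
  shows "H10 \<Omega> v k"
proof -
  have "\<forall>n. \<exists>\<psi> d. C1c \<Omega> \<psi> d \<and> sqint lborel (\<lambda>x. \<psi> x - u n x) < inverse (real (Suc n))
      \<and> sqint lborel (\<lambda>x. d x - g n x) < inverse (real (Suc n))"
  proof
    fix n
    obtain \<psi> d where 1: "\<And>m. C1c \<Omega> (\<psi> m) (d m)"
      "(\<lambda>m. sqint lborel (\<lambda>x. \<psi> m x - u n x)) \<longlonglongrightarrow> 0" "(\<lambda>m. sqint lborel (\<lambda>x. d m x - g n x)) \<longlonglongrightarrow> 0"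
      by (rule H10_approx[OF H[of n]]) blast
    have p: "0 < inverse (real (Suc n))" by simp
    have "\<forall>\<^sub>F m in sequentially. sqint lborel (\<lambda>x. \<psi> m x - u n x) < inverse (real (Suc n))
      \<and> sqint lborel (\<lambda>x. d m x - g n x) < inverse (real (Suc n))"
      by (intro eventually_conj order_tendstoD(2)[OF 1(2) p] order_tendstoD(2)[OF 1(3) p])
    from eventually_happens'[OF sequentially_bot this]
    show "\<exists>\<psi> d. C1c \<Omega> \<psi> d \<and> sqint lborel (\<lambda>x. \<psi> x - u n x) < inverse (real (Suc n))
      \<and> sqint lborel (\<lambda>x. d x - g n x) < inverse (real (Suc n))" using 1(1) by blast
  qed
  then obtain \<psi> d where C: "\<And>n. C1c \<Omega> (\<psi> n) (d n)"
    and s: "\<And>n. sqint lborel (\<lambda>x. \<psi> n x - u n x) < inverse (real (Suc n))"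
      "\<And>n. sqint lborel (\<lambda>x. d n x - g n x) < inverse (real (Suc n))"
    unfolding choice_iff by blast
  have z: "(\<lambda>n. sqint lborel (\<lambda>x. \<psi> n x - u n x)) \<longlonglongrightarrow> 0" "(\<lambda>n. sqint lborel (\<lambda>x. d n x - g n x)) \<longlonglongrightarrow> 0"
    by (rule Lim_null_comparison[OF _ LIMSEQ_inverse_real_of_nat],
        use s in \<open>auto simp: sqint_nonneg less_imp_le\<close>)+
  note LL = L H10_L2[OF H] C1c_L2[OF C]
  have "(\<lambda>n. sqint lborel (\<lambda>x. (\<psi> n x - u n x) + (u n x - v x))) \<longlonglongrightarrow> 0"
    "(\<lambda>n. sqint lborel (\<lambda>x. (d n x - g n x) + (g n x - k x))) \<longlonglongrightarrow> 0"
    by (intro sqint_add_tendsto_0 L2_diff LL z lim)+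
  then show ?thesis unfolding H10_iff using C L by auto
qed

subsection \<open>The obstacle problem\<close>

locale bounded_domain =
  fixes \<Omega> :: "pt set"
  assumes open_domain: "open \<Omega>" and bounded_domain: "bounded \<Omega>"
begin

abbreviation mass :: "(pt \<Rightarrow> real) \<Rightarrow> real" where
  "mass u \<equiv> (LINT x:\<Omega>|lborel. u x)"

text \<open>Since the domain is bounded, its indicator is square integrable, so Cauchy-Schwarz and
  continuity of the inner product apply to \<open>mass\<close>.\<close>

lemma mass_eq_inner: "mass u = (\<integral>x. indicat_real \<Omega> x \<bullet> u x \<partial>lborel)"
  by (simp add: set_lebesgue_integral_def)

lemma L2_indicator: "L2 lborel (indicat_real \<Omega>)"
proof -
  have "(\<lambda>x. (norm (indicat_real \<Omega> x))\<^sup>2) = indicat_real \<Omega>" by (auto simp: indicator_def)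
  moreover have "integrable lborel (indicat_real \<Omega>)"
    using open_domain emeasure_bounded_finite[OF bounded_domain]
    by (intro integrable_real_indicator) auto
  ultimately show ?thesis using open_domain by (simp add: L2_def)
qed

lemma set_integrable_L2: "L2 lborel u \<Longrightarrow> set_integrable lborel \<Omega> (u :: pt \<Rightarrow> real)"
  using L2_integrable_inner[OF L2_indicator] by (simp add: set_integrable_def)

lemma mass_add: "L2 lborel u \<Longrightarrow> L2 lborel v \<Longrightarrow> mass (\<lambda>x. u x + v x) = mass u + mass v"
  by (intro set_integral_add set_integrable_L2)

lemma mass_diff: "L2 lborel u \<Longrightarrow> L2 lborel v \<Longrightarrow> mass (\<lambda>x. u x - v x) = mass u - mass v"
  by (intro set_integral_diff set_integrable_L2)

lemma mass_scaleR: "mass (\<lambda>x. c *\<^sub>R u x) = c * mass u"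
  by simp

lemma mass_nonneg:
  assumes "AE x in lborel. 0 \<le> u x" shows "0 \<le> mass u"
  unfolding set_lebesgue_integral_def
  by (rule integral_nonneg_AE) (use assms in \<open>auto simp: indicator_def\<close>)

lemma Poincare:
  obtains C where "0 \<le> C" "\<And>u g. H10 \<Omega> u g \<Longrightarrow> sqint lborel u \<le> C * sqint lborel g"
proof -
  obtain R where "\<Omega> \<subseteq> cball 0 R"
    using bounded_domain by (auto simp: bounded_iff subset_iff)
  then show ?thesis using that[of "16 * R\<^sup>2"] Poincare_H10 by simp
qed

lemma inK_L2: "inK \<Omega> u g \<Longrightarrow> L2 lborel u" "inK \<Omega> u g \<Longrightarrow> L2 lborel g"
  unfolding inK_def using H10_L2 by blast+

lemma inK_mass_nonneg: "inK \<Omega> u g \<Longrightarrow> 0 \<le> mass u"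
  by (rule mass_nonneg) (simp add: inK_def)

lemma inK_zero: "inK \<Omega> (\<lambda>_. 0) (\<lambda>_. 0)"
  by (simp add: inK_def C1c_imp_H10 C1c_zero)

lemma inK_add: "inK \<Omega> u g \<Longrightarrow> inK \<Omega> v k \<Longrightarrow> inK \<Omega> (\<lambda>x. u x + v x) (\<lambda>x. g x + k x)"
  by (auto simp: inK_def H10_add)

lemma inK_scaleR: "inK \<Omega> u g \<Longrightarrow> 0 \<le> c \<Longrightarrow> inK \<Omega> (\<lambda>x. c *\<^sub>R u x) (\<lambda>x. c *\<^sub>R g x)"
  using H10_scaleR[of \<Omega> u g c] by (auto simp: inK_def)

section \<open>Existence of an energy minimiser\<close>

definition energy :: "(pt \<Rightarrow> real) \<Rightarrow> (pt \<Rightarrow> pt) \<Rightarrow> real" where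
  "energy u g = sqint lborel g / 2 - mass u"

lemma energy_bounded_below: "\<exists>m. \<forall>u g. inK \<Omega> u g \<longrightarrow> m \<le> energy u g"
proof -
  obtain C where C: "0 \<le> C" "\<And>u g. H10 \<Omega> u g \<Longrightarrow> sqint lborel u \<le> C * sqint lborel g"
    using Poincare by metis
  \<comment> \<open>Cauchy-Schwarz and Poincare give \<open>mass u \<le> a * s\<close> with
    \<open>s\<close> the norm of the gradient, and \<open>s\<^sup>2 / 2 - a * s\<close> is bounded
    below by \<open>- a\<^sup>2\<close>.\<close>
  define a where "a = sqrt (sqint lborel (indicat_real \<Omega>)) * sqrt C"
  have "- a\<^sup>2 \<le> energy u g" if K: "inK \<Omega> u g" for u g
  proof -
    define s where "s = sqrt (sqint lborel g)"
    have s: "s\<^sup>2 = sqint lborel g" by (simp add: s_def sqint_nonneg)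
    have "mass u \<le> sqrt (sqint lborel (indicat_real \<Omega>)) * sqrt (sqint lborel u)"
      using L2_Cauchy_Schwarz[OF L2_indicator inK_L2(1)[OF K]] unfolding mass_eq_inner by linarith
    also have "\<dots> \<le> sqrt (sqint lborel (indicat_real \<Omega>)) * sqrt (C * sqint lborel g)"
      using C(2)[of u g] K by (intro mult_left_mono real_sqrt_le_mono) (auto simp: inK_def sqint_nonneg)
    also have "\<dots> = a * s" by (simp add: a_def s_def real_sqrt_mult)
    finally have "mass u \<le> a * s" .
    moreover have "a * s \<le> s\<^sup>2 / 2 + a\<^sup>2"
      using sum_squares_bound[of a s] zero_le_power2[of a] unfolding mult.assoc by linarith
    ultimately show ?thesis unfolding energy_def s[symmetric] by linarith
  qed
  then show ?thesis by blast
qed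

text \<open>The direct method in its convex form: the midpoint of two near-minimisers lies in
  \<open>K\<close>, so the parallelogram law makes the gradients of a minimising sequence Cauchy.
  Poincare transfers this to the functions.\<close>

lemma energy_minimizer:
  obtains w gw where "inK \<Omega> w gw" "\<And>u g. inK \<Omega> u g \<Longrightarrow> energy w gw \<le> energy u g"
proof -
  define S where "S = {energy u g | u g. inK \<Omega> u g}"
  define m where "m = Inf S"
  have bdd: "bdd_below S"
    using energy_bounded_below unfolding S_def bdd_below_def by blast
  have ne: "S \<noteq> {}" using inK_zero unfolding S_def by blast
  have m_le: "m \<le> energy u g" if "inK \<Omega> u g" for u g
    unfolding m_def by (rule cInf_lower[OF _ bdd]) (use that in \<open>auto simp: S_def\<close>)
  have "\<forall>n. \<exists>u g. inK \<Omega> u g \<and> energy u g < m + inverse (real (Suc n))"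
  proof
    fix n
    have "Inf S < m + inverse (real (Suc n))" by (simp add: m_def)
    then obtain s where "s \<in> S" "s < m + inverse (real (Suc n))"
      using cInf_lessD[OF ne] by blast
    then show "\<exists>u g. inK \<Omega> u g \<and> energy u g < m + inverse (real (Suc n))"
      by (auto simp: S_def)
  qed
  then obtain u g where K: "\<And>n. inK \<Omega> (u n) (g n)"
    and en: "\<And>n. energy (u n) (g n) < m + inverse (real (Suc n))"
    unfolding choice_iff by blast
  note L = inK_L2[OF K]
  have g_cauchy: "sqint lborel (\<lambda>x. g i x - g j x) \<le> 4 * inverse (real (Suc i)) + 4 * inverse (real (Suc j))" for i j
  proof -
    \<comment> \<open>Comparing \<open>m\<close> with the energy of the midpoint bounds one eighth
      of the squared distance of the gradients by the mean excess of the two energies over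
      \<open>m\<close>; hence the factors 4.\<close>
    have "inK \<Omega> (\<lambda>x. (1/2) *\<^sub>R (u i x + u j x)) (\<lambda>x. (1/2) *\<^sub>R (g i x + g j x))"
      by (intro inK_scaleR inK_add K) simp
    then have "m \<le> sqint lborel (\<lambda>x. (1/2) *\<^sub>R (g i x + g j x)) / 2 - mass (\<lambda>x. (1/2) *\<^sub>R (u i x + u j x))"
      using m_le unfolding energy_def by blast
    also have "\<dots> = sqint lborel (\<lambda>x. g i x + g j x) / 8 - (mass (u i) + mass (u j)) / 2"
      unfolding sqint_scaleR mass_scaleR mass_add[OF L(1) L(1)] by (simp add: power2_eq_square)
    finally show ?thesis
      using sqint_add_eq[OF L(2)[of i] L(2)[of j]] sqint_diff_eq[OF L(2)[of i] L(2)[of j]] en[of i] en[of j]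
      unfolding energy_def by argo
  qed
  have inv_small: "\<exists>N. \<forall>i\<ge>N. inverse (real (Suc i)) < e" if "e > 0" for e :: real
    using order_tendstoD(2)[OF LIMSEQ_inverse_real_of_nat that] by (simp add: eventually_sequentially)
  have gC: "\<exists>N. \<forall>i\<ge>N. \<forall>j\<ge>N. sqint lborel (\<lambda>x. g i x - g j x) < e" if "e > 0" for e
  proof -
    obtain N where N: "\<forall>i\<ge>N. inverse (real (Suc i)) < e / 8" using inv_small[of "e/8"] \<open>e > 0\<close> by auto
    have "sqint lborel (\<lambda>x. g i x - g j x) < e" if "i \<ge> N" "j \<ge> N" for i j
    proof -
      have "inverse (real (Suc i)) < e / 8" "inverse (real (Suc j)) < e / 8"
        using that N by blast+
      then show ?thesis using g_cauchy[of i j] by argo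
    qed
    then show ?thesis by blast
  qed
  obtain C where C: "0 \<le> C" "\<And>u g. H10 \<Omega> u g \<Longrightarrow> sqint lborel u \<le> C * sqint lborel g"
    using Poincare by metis
  have uC: "\<exists>N. \<forall>i\<ge>N. \<forall>j\<ge>N. sqint lborel (\<lambda>x. u i x - u j x) < e" if "e > 0" for e
  proof -
    \<comment> \<open>\<open>C + 1\<close> instead of \<open>C\<close>, because \<open>C\<close> may
      be 0.\<close>
    obtain N where N: "\<forall>i\<ge>N. \<forall>j\<ge>N. sqint lborel (\<lambda>x. g i x - g j x) < e / (C + 1)"
      using gC[of "e / (C + 1)"] \<open>e > 0\<close> C(1) by auto
    have "sqint lborel (\<lambda>x. u i x - u j x) < e" if "i \<ge> N" "j \<ge> N" for i j
    proof -
      have "sqint lborel (\<lambda>x. u i x - u j x) \<le> C * sqint lborel (\<lambda>x. g i x - g j x)"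
        by (intro C H10_diff) (use K in \<open>auto simp: inK_def\<close>)
      also have "\<dots> \<le> (C + 1) * sqint lborel (\<lambda>x. g i x - g j x)"
        by (intro mult_right_mono sqint_nonneg) simp
      also have "\<dots> < e" using N that C(1) by (simp add: pos_less_divide_eq mult.commute)
      finally show ?thesis .
    qed
    then show ?thesis by blast
  qed
  obtain gw where gw: "L2 lborel gw" "(\<lambda>n. sqint lborel (\<lambda>x. g n x - gw x)) \<longlonglongrightarrow> 0"
    by (rule L2_complete[OF L(2) gC]) auto
  obtain w r where w: "L2 lborel w" "(\<lambda>n. sqint lborel (\<lambda>x. u n x - w x)) \<longlonglongrightarrow> 0"
    and r: "AE x in lborel. (\<lambda>n. u (r n) x) \<longlonglongrightarrow> w x"
    by (rule L2_complete[OF L(1) uC]) auto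
  have "AE x in lborel. \<forall>n. 0 \<le> u n x"
    using K unfolding inK_def AE_all_countable by blast
  with r have "AE x in lborel. 0 \<le> w x"
    by eventually_elim (auto intro: LIMSEQ_le_const)
  moreover have "H10 \<Omega> w gw"
    by (rule H10_closed[OF _ w(1) gw(1) w(2) gw(2)]) (use K in \<open>auto simp: inK_def\<close>)
  ultimately have Kw: "inK \<Omega> w gw" by (simp add: inK_def)
  \<comment> \<open>Dropping the square of \<open>gw - g n\<close> leaves errors that are inner
    products with the fixed functions \<open>gw\<close> and the indicator. They tend to zero by
    strong convergence, so the limit attains the infimum.\<close>
  have le: "energy w gw \<le> m + (inverse (real (Suc n)) + (\<integral>x. gw x \<bullet> (gw x - g n x) \<partial>lborel)
      + (\<integral>x. indicat_real \<Omega> x \<bullet> (u n x - w x) \<partial>lborel))" for n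
  proof -
    have "sqint lborel gw \<le> sqint lborel (g n) + 2 * (\<integral>x. gw x \<bullet> (gw x - g n x) \<partial>lborel)"
      using sqint_diff_eq[OF gw(1) L2_diff[OF gw(1) L(2)[of n]]]
        sqint_nonneg[of lborel "\<lambda>x. gw x - g n x"] by simp
    moreover have "(\<integral>x. indicat_real \<Omega> x \<bullet> (u n x - w x) \<partial>lborel) = mass (u n) - mass w"
      unfolding mass_eq_inner[symmetric] by (rule mass_diff[OF L(1) w(1)])
    ultimately show ?thesis using en[of n] unfolding energy_def by linarith
  qed
  have "(\<lambda>n. m + (inverse (real (Suc n)) + (\<integral>x. gw x \<bullet> (gw x - g n x) \<partial>lborel)
      + (\<integral>x. indicat_real \<Omega> x \<bullet> (u n x - w x) \<partial>lborel))) \<longlonglongrightarrow> m + (0 + 0 + 0)"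
  proof (intro tendsto_add tendsto_const LIMSEQ_inverse_real_of_nat)
    have "(\<lambda>n. sqint lborel (\<lambda>x. gw x - g n x)) \<longlonglongrightarrow> 0"
      using gw(2) by (subst sqint_minus_commute)
    then show "(\<lambda>n. \<integral>x. gw x \<bullet> (gw x - g n x) \<partial>lborel) \<longlonglongrightarrow> 0"
      by (intro L2_inner_tendsto_0 gw(1) L2_diff L)
    show "(\<lambda>n. \<integral>x. indicat_real \<Omega> x \<bullet> (u n x - w x) \<partial>lborel) \<longlonglongrightarrow> 0"
      by (intro L2_inner_tendsto_0 L2_indicator w L2_diff L)
  qed
  from LIMSEQ_le_const[OF this, of "energy w gw"] have "energy w gw \<le> m + (0 + 0 + 0)"
    using le by blast
  then have "energy w gw \<le> m" by simp
  then show ?thesis using that[OF Kw] m_le by (meson order_trans)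
qed

text \<open>Since \<open>K\<close> is a cone, the variational inequality with unit load splits into an energy identity
  and an inequality against every element of \<open>K\<close>.\<close>
lemma obstacle_solution:
  obtains w gw where "inK \<Omega> w gw" "sqint lborel gw = mass w"
    "\<And>\<phi> k. inK \<Omega> \<phi> k \<Longrightarrow> mass \<phi> \<le> (\<integral>x. gw x \<bullet> k x \<partial>lborel)"
proof -
  obtain w gw where K: "inK \<Omega> w gw" and min: "\<And>u g. inK \<Omega> u g \<Longrightarrow> energy w gw \<le> energy u g"
    using energy_minimizer by metis
  note L = inK_L2[OF K]
  have VI: "mass \<phi> - mass w \<le> (\<integral>x. gw x \<bullet> k x \<partial>lborel) - sqint lborel gw" if \<phi>: "inK \<Omega> \<phi> k" for \<phi> k
  proof (rule ccontr)
    note L\<phi> = inK_L2[OF \<phi>]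
    let ?h = "\<lambda>x. k x - gw x"
    define a where "a = (\<integral>x. gw x \<bullet> ?h x \<partial>lborel)"
    define b where "b = mass \<phi> - mass w"
    define c where "c = sqint lborel ?h"
    have a: "a = (\<integral>x. gw x \<bullet> k x \<partial>lborel) - sqint lborel gw"
      using L2_integrable_inner[OF L(2) L\<phi>(2)] L2_integrable_inner[OF L(2) L(2)]
      by (simp add: a_def inner_diff_right sqint_def power2_norm_eq_inner)
    assume "\<not> ?thesis"
    then have lt: "a < b" unfolding a b_def by linarith
    \<comment> \<open>Moving from \<open>w\<close> towards \<open>\<phi>\<close> by \<open>t\<close>
      changes the energy by \<open>t * (a - b) + t\<^sup>2 * c / 2\<close>. This \<open>t\<close> is
      small enough for the negative linear term to win; \<open>c + 1\<close> guards against
      \<open>c = 0\<close>.\<close>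
    define t where "t = min 1 ((b - a) / (c + 1))"
    have c: "0 \<le> c" unfolding c_def by (rule sqint_nonneg)
    have t: "0 < t" "t \<le> 1" "t * c < 2 * (b - a)"
    proof -
      show "0 < t" "t \<le> 1" using lt c by (auto simp: t_def)
      have "t * c \<le> (b - a) / (c + 1) * c" using c by (intro mult_right_mono) (auto simp: t_def)
      also have "\<dots> \<le> b - a" using lt c by (simp add: field_simps)
      finally show "t * c < 2 * (b - a)" using lt by simp
    qed
    have "inK \<Omega> (\<lambda>x. (1 - t) *\<^sub>R w x + t *\<^sub>R \<phi> x) (\<lambda>x. (1 - t) *\<^sub>R gw x + t *\<^sub>R k x)"
      using t by (intro inK_add inK_scaleR K \<phi>) auto
    then have "energy w gw \<le> energy (\<lambda>x. (1 - t) *\<^sub>R w x + t *\<^sub>R \<phi> x) (\<lambda>x. (1 - t) *\<^sub>R gw x + t *\<^sub>R k x)"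
      by (rule min)
    also have "\<dots> = energy (\<lambda>x. (1 - t) *\<^sub>R w x + t *\<^sub>R \<phi> x) (\<lambda>x. gw x + t *\<^sub>R ?h x)"
      by (simp add: algebra_simps)
    also have "mass (\<lambda>x. (1 - t) *\<^sub>R w x + t *\<^sub>R \<phi> x) = (1 - t) * mass w + t * mass \<phi>"
      using mass_add[OF L2_scaleR[OF L(1)] L2_scaleR[OF L\<phi>(1)]] unfolding mass_scaleR .
    then have "energy (\<lambda>x. (1 - t) *\<^sub>R w x + t *\<^sub>R \<phi> x) (\<lambda>x. gw x + t *\<^sub>R ?h x)
        = (sqint lborel gw + 2 * (t * a) + t\<^sup>2 * c) / 2 - ((1 - t) * mass w + t * mass \<phi>)"
      using sqint_add_eq[OF L(2) L2_scaleR[OF L2_diff[OF L\<phi>(2) L(2)], of t]]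
      by (simp add: energy_def sqint_scaleR a_def c_def)
    finally have "0 \<le> t * (a - b + t * c / 2)"
      by (simp add: energy_def b_def power2_eq_square algebra_simps add_divide_distrib)
    then have "0 \<le> a - b + t * c / 2" using t(1) by (simp add: zero_le_mult_iff)
    then show False using t(3) by argo
  qed
  \<comment> \<open>The test functions 0 and \<open>2 w\<close>, both in the cone, give the two
    halves of the energy identity.\<close>
  have "- mass w \<le> - sqint lborel gw" using VI[OF inK_zero] by simp
  moreover have ww: "(\<integral>x. gw x \<bullet> gw x \<partial>lborel) = sqint lborel gw" by (simp add: sqint_def power2_norm_eq_inner)
  have "mass w \<le> sqint lborel gw"
    using VI[OF inK_scaleR[OF K, of 2]] ww by simp
  ultimately have eq: "sqint lborel gw = mass w" by simp
  show ?thesis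
    by (rule that[OF K eq]) (use VI eq in fastforce)
qed

text \<open>A squared paraboloid cap on a small ball: the square makes the cut-off C1 across the
  sphere. It is the test function that forces \<open>mass w > 0\<close>.\<close>

lemma exists_positive_mass:
  assumes "\<Omega> \<noteq> {}"
  obtains \<phi> k where "inK \<Omega> \<phi> k" "0 < mass \<phi>"
proof -
  obtain z r where r: "0 < r" "cball z r \<subseteq> \<Omega>"
    using assms open_domain open_contains_cball by blast
  define m where "m x = max 0 (r\<^sup>2 - (x - z) \<bullet> (x - z))" for x
  have C: "C1c \<Omega> (\<lambda>x. (m x)\<^sup>2) (\<lambda>x. (- 4 * m x) *\<^sub>R (x - z))"
    unfolding C1c_def
  proof (intro conjI allI exI[of _ "cball z r"])
    fix x
    have "((\<lambda>x. r\<^sup>2 - (x - z) \<bullet> (x - z)) has_derivative (\<lambda>h. - 2 * ((x - z) \<bullet> h))) (at x)"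
      by (auto intro!: derivative_eq_intros simp: inner_commute)
    from has_derivative_compose[OF this DERIV_square_positive_part[of "r\<^sup>2 - (x - z) \<bullet> (x - z)", unfolded has_field_derivative_def]]
    show "((\<lambda>x. (m x)\<^sup>2) has_derivative (\<lambda>h. (- 4 * m x) *\<^sub>R (x - z) \<bullet> h)) (at x)"
      by (simp add: m_def mult.assoc)
    show "continuous_on UNIV (\<lambda>x. (- 4 * m x) *\<^sub>R (x - z))"
      unfolding m_def by (intro continuous_intros)
    show "x \<notin> cball z r \<longrightarrow> (m x)\<^sup>2 = 0"
    proof
      assume "x \<notin> cball z r"
      then have "r\<^sup>2 \<le> (norm (x - z))\<^sup>2" using r by (intro power_mono) (auto simp: dist_norm norm_minus_commute)
      then show "(m x)\<^sup>2 = 0" by (simp add: m_def power2_norm_eq_inner)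
    qed
  qed (use r in auto)
  then have K: "inK \<Omega> (\<lambda>x. (m x)\<^sup>2) (\<lambda>x. (- 4 * m x) *\<^sub>R (x - z))"
    by (simp add: inK_def C1c_imp_H10)
  have "mass (\<lambda>x. (m x)\<^sup>2) \<noteq> 0"
  proof
    assume "mass (\<lambda>x. (m x)\<^sup>2) = 0"
    then have "AE x in lborel. indicat_real \<Omega> x *\<^sub>R (m x)\<^sup>2 = 0"
      unfolding set_lebesgue_integral_def
      by (subst (asm) integral_nonneg_eq_0_iff_AE)
        (use set_integrable_L2[OF inK_L2(1)[OF K]] in \<open>auto simp: set_integrable_def\<close>)
    then have "AE x in lborel. x \<notin> ball z r"
    proof eventually_elim
      case (elim x)
      show ?case
      proof
        assume x: "x \<in> ball z r"
        then have "(norm (x - z))\<^sup>2 < r\<^sup>2" by (intro power_strict_mono) (auto simp: dist_norm norm_minus_commute)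
        then have "m x > 0" by (simp add: m_def power2_norm_eq_inner)
        then show False using elim x subsetD[OF r(2), of x] by (auto simp: indicator_def)
      qed
    qed
    then have "emeasure lborel (ball z r) = 0"
      by (subst (asm) AE_iff_measurable[of "ball z r"]) auto
    then show False
      using r(1) unit_ball_vol_pos[of 2] by (simp add: emeasure_ball)
  qed
  then have "0 < mass (\<lambda>x. (m x)\<^sup>2)" using inK_mass_nonneg[OF K] by linarith
  then show ?thesis using that K by blast
qed

section \<open>The closed form of \<open>Gfun\<close>\<close>

text \<open>The gradient of \<open>q\<close> vanishes almost everywhere outside the domain, so the
  integral over the domain is one over the plane and splits into an inner product and a
  square.\<close>

lemma vi_sol_zero_iff:
  "vi_sol \<Omega> (\<lambda>_. 0) \<beta> \<gamma> q gq \<longleftrightarrow> inK \<Omega> q gq \<and>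
    (\<forall>\<phi> k. inK \<Omega> \<phi> k \<longrightarrow>
      - \<gamma> * (mass \<phi> - mass q) \<le> \<beta> ^ 3 * ((\<integral>x. gq x \<bullet> k x \<partial>lborel) - sqint lborel gq))"
proof -
  have "(LINT x:\<Omega>|lborel. (0 + \<beta>) ^ 3 * (gq x \<bullet> (k x - gq x)))
      = \<beta> ^ 3 * ((\<integral>x. gq x \<bullet> k x \<partial>lborel) - sqint lborel gq)"
    and "(LINT x:\<Omega>|lborel. \<phi> x - q x) = mass \<phi> - mass q"
    if q: "inK \<Omega> q gq" and \<phi>: "inK \<Omega> \<phi> k" for \<phi> k
  proof -
    note L = inK_L2[OF q] inK_L2[OF \<phi>]
    have [measurable]: "gq \<in> borel_measurable borel" "k \<in> borel_measurable borel" "\<Omega> \<in> sets borel"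
      using L open_domain by (auto simp: L2_def)
    have "H10 \<Omega> q gq" using q by (simp add: inK_def)
    from H10_AE_eq_0_outside(2)[OF this open_domain]
    have "AE x in lborel. indicat_real \<Omega> x *\<^sub>R ((0 + \<beta>) ^ 3 * (gq x \<bullet> (k x - gq x))) = \<beta> ^ 3 * (gq x \<bullet> (k x - gq x))"
      by eventually_elim (auto simp: indicator_def)
    then have "(LINT x:\<Omega>|lborel. (0 + \<beta>) ^ 3 * (gq x \<bullet> (k x - gq x))) = (\<integral>x. \<beta> ^ 3 * (gq x \<bullet> (k x - gq x)) \<partial>lborel)"
      unfolding set_lebesgue_integral_def by (intro integral_cong_AE) auto
    also have "\<dots> = \<beta> ^ 3 * ((\<integral>x. gq x \<bullet> k x \<partial>lborel) - sqint lborel gq)"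
      using L2_integrable_inner[OF L(2) L(4)] L2_integrable_inner[OF L(2) L(2)]
      by (simp add: inner_diff_right sqint_def power2_norm_eq_inner)
    finally show "(LINT x:\<Omega>|lborel. (0 + \<beta>) ^ 3 * (gq x \<bullet> (k x - gq x)))
      = \<beta> ^ 3 * ((\<integral>x. gq x \<bullet> k x \<partial>lborel) - sqint lborel gq)" .
    show "(LINT x:\<Omega>|lborel. \<phi> x - q x) = mass \<phi> - mass q" by (rule mass_diff[OF L(3,1)])
  qed
  then show ?thesis unfolding vi_sol_def by (auto simp del: add_0)
qed

text \<open>Testing each inequality with the other solution and adding cancels the terms in
  \<open>\<gamma>\<close> and leaves minus the squared distance of the gradients, times
  \<open>\<beta> ^ 3\<close>, nonnegative. Poincare then handles the functions.\<close>

lemma vi_sol_mass_unique: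
  assumes "0 < \<beta>" and 1: "vi_sol \<Omega> (\<lambda>_. 0) \<beta> \<gamma> p gp" and 2: "vi_sol \<Omega> (\<lambda>_. 0) \<beta> \<gamma> q gq"
  shows "mass p = mass q"
proof -
  have K: "inK \<Omega> p gp" "inK \<Omega> q gq" using 1 2 by (auto simp: vi_sol_zero_iff)
  note L = inK_L2[OF K(1)] inK_L2[OF K(2)]
  have "- \<gamma> * (mass q - mass p) \<le> \<beta> ^ 3 * ((\<integral>x. gp x \<bullet> gq x \<partial>lborel) - sqint lborel gp)"
    "- \<gamma> * (mass p - mass q) \<le> \<beta> ^ 3 * ((\<integral>x. gp x \<bullet> gq x \<partial>lborel) - sqint lborel gq)"
    using 1 2 K(1)[THEN 2[unfolded vi_sol_zero_iff, THEN conjunct2, rule_format]]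
      K(2)[THEN 1[unfolded vi_sol_zero_iff, THEN conjunct2, rule_format]]
    by (simp_all add: inner_commute)
  then have "0 \<le> \<beta> ^ 3 * (2 * (\<integral>x. gp x \<bullet> gq x \<partial>lborel) - sqint lborel gp - sqint lborel gq)"
    by (simp add: algebra_simps)
  then have "0 \<le> 2 * (\<integral>x. gp x \<bullet> gq x \<partial>lborel) - sqint lborel gp - sqint lborel gq"
    using assms(1) by (simp add: zero_le_mult_iff)
  then have "sqint lborel (\<lambda>x. gp x - gq x) = 0"
    using sqint_diff_eq[OF L(2,4)] sqint_nonneg[of lborel "\<lambda>x. gp x - gq x"] by linarith
  moreover obtain C where "0 \<le> C" "\<And>u g. H10 \<Omega> u g \<Longrightarrow> sqint lborel u \<le> C * sqint lborel g"
    using Poincare by metis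
  moreover have "H10 \<Omega> (\<lambda>x. p x - q x) (\<lambda>x. gp x - gq x)"
    using K by (auto simp: inK_def H10_diff)
  ultimately have "sqint lborel (\<lambda>x. p x - q x) = 0"
    using sqint_nonneg[of lborel "\<lambda>x. p x - q x"] by fastforce
  then have "\<bar>mass (\<lambda>x. p x - q x)\<bar> \<le> 0"
    using L2_Cauchy_Schwarz[OF L2_indicator L2_diff[OF L(1,3)]] unfolding mass_eq_inner by simp
  then show ?thesis using mass_diff[OF L(1,3)] by linarith
qed

theorem Gfun_formula:
  assumes "\<Omega> \<noteq> {}"
  obtains A where "0 < A" "\<And>F \<beta> \<gamma>. 0 < \<beta> \<Longrightarrow> Gfun \<Omega> F \<beta> \<gamma> = A * max 0 (- \<gamma>) / \<beta> ^ 3 - F"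
proof -
  obtain w gw where K: "inK \<Omega> w gw" and sq: "sqint lborel gw = mass w"
    and VI: "\<And>\<phi> k. inK \<Omega> \<phi> k \<Longrightarrow> mass \<phi> \<le> (\<integral>x. gw x \<bullet> k x \<partial>lborel)"
    by (rule obstacle_solution) blast
  have "mass w \<noteq> 0"
  proof
    assume "mass w = 0"
    \<comment> \<open>Zero mass means zero gradient norm by the energy identity, so the right-hand
      side of \<open>VI\<close> would vanish for every test function.\<close>
    obtain \<phi> k where \<phi>: "inK \<Omega> \<phi> k" "0 < mass \<phi>" using exists_positive_mass[OF assms] .
    have "\<bar>\<integral>x. gw x \<bullet> k x \<partial>lborel\<bar> \<le> 0"
      using L2_Cauchy_Schwarz[OF inK_L2(2)[OF K] inK_L2(2)[OF \<phi>(1)]] sq \<open>mass w = 0\<close> by simp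
    then show False using VI[OF \<phi>(1)] \<phi>(2) by linarith
  qed
  then have pos: "0 < mass w" using inK_mass_nonneg[OF K] by linarith
  have "Gfun \<Omega> F \<beta> \<gamma> = mass w * max 0 (- \<gamma>) / \<beta> ^ 3 - F" if "0 < \<beta>" for F \<beta> \<gamma>
  proof -
    define c where "c = max 0 (- \<gamma>) / \<beta> ^ 3"
    have c: "0 \<le> c" "\<beta> ^ 3 * c = max 0 (- \<gamma>)" using that by (auto simp: c_def)
    have sol: "vi_sol \<Omega> (\<lambda>_. 0) \<beta> \<gamma> (\<lambda>x. c *\<^sub>R w x) (\<lambda>x. c *\<^sub>R gw x)"
      unfolding vi_sol_zero_iff
    proof (intro conjI allI impI inK_scaleR K c(1))
      fix \<phi> k assume \<phi>: "inK \<Omega> \<phi> k"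
      \<comment> \<open>An equality if \<open>\<gamma> < 0\<close>. If
        \<open>\<gamma> \<ge> 0\<close>, then \<open>c = 0\<close> and the left side is nonpositive
        because elements of \<open>K\<close> have nonnegative mass.\<close>
      have "- \<gamma> * (mass \<phi> - c * mass w) \<le> max 0 (- \<gamma>) * (mass \<phi> - c * mass w)"
      proof (cases "\<gamma> \<ge> 0")
        case True
        then have "c = 0" by (simp add: c_def)
        then show ?thesis using True inK_mass_nonneg[OF \<phi>] by (simp add: mult_nonneg_nonneg)
      qed simp
      also have "\<dots> = \<beta> ^ 3 * (c * mass \<phi> - c\<^sup>2 * mass w)"
        unfolding c(2)[symmetric] by (simp add: power2_eq_square algebra_simps)
      also have "\<dots> \<le> \<beta> ^ 3 * (c * (\<integral>x. gw x \<bullet> k x \<partial>lborel) - c\<^sup>2 * mass w)"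
        using that c(1) VI[OF \<phi>] by (intro mult_left_mono diff_right_mono) auto
      finally show "- \<gamma> * (mass \<phi> - mass (\<lambda>x. c *\<^sub>R w x))
          \<le> \<beta> ^ 3 * ((\<integral>x. c *\<^sub>R gw x \<bullet> k x \<partial>lborel) - sqint lborel (\<lambda>x. c *\<^sub>R gw x))"
        unfolding mass_scaleR sqint_scaleR sq by simp
    qed
    have "Gfun \<Omega> F \<beta> \<gamma> = mass (\<lambda>x. c *\<^sub>R w x) - F"
      unfolding Gfun_def
      by (rule the_equality) (use sol vi_sol_mass_unique[OF that _ sol] in fastforce)+
    then show ?thesis by (simp only: mass_scaleR) (simp add: c_def)
  qed
  with pos show ?thesis by (rule that)
qed

end

subsection \<open>Ordinary differential equations\<close>

lemma nonincreasing_if_deriv_nonpos: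
  fixes f :: "real \<Rightarrow> real"
  assumes "a \<le> b" and der: "\<And>t. t \<in> {a..b} \<Longrightarrow> (f has_real_derivative f' t) (at t within {a..b})"
    and le: "\<And>t. t \<in> {a..b} \<Longrightarrow> f' t \<le> 0"
  shows "f b \<le> f a"
proof (rule DERIV_nonpos_imp_decreasing_open[OF \<open>a \<le> b\<close>])
  show "\<exists>y. (f has_real_derivative y) (at x) \<and> y \<le> 0" if "a < x" "x < b" for x
    using der[of x] le[of x] that at_within_Icc_at[of a x b] by fastforce
  show "continuous_on {a..b} f"
    by (rule DERIV_continuous_on[OF der])
qed

text \<open>Barrier principle without a first exit time: \<open>(max 0 (f t))\<^sup>2\<close> is
  differentiable, its derivative is nonpositive on the whole interval, and it starts at 0.\<close>

lemma nonpos_if_deriv_nonpos_where_pos: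
  fixes f :: "real \<Rightarrow> real"
  assumes "a \<le> b" and der: "\<And>t. t \<in> {a..b} \<Longrightarrow> (f has_real_derivative f' t) (at t within {a..b})"
    and le: "\<And>t. t \<in> {a..b} \<Longrightarrow> 0 < f t \<Longrightarrow> f' t \<le> 0" and "f a \<le> 0"
  shows "f b \<le> 0"
proof -
  have "(max 0 (f b))\<^sup>2 \<le> (max 0 (f a))\<^sup>2"
  proof (rule nonincreasing_if_deriv_nonpos[OF \<open>a \<le> b\<close>])
    fix t assume t: "t \<in> {a..b}"
    show "((\<lambda>t. (max 0 (f t))\<^sup>2) has_real_derivative 2 * max 0 (f t) * f' t) (at t within {a..b})"
      by (rule DERIV_chain2[OF DERIV_square_positive_part der[OF t]])
    show "2 * max 0 (f t) * f' t \<le> 0"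
      using le[OF t] by (cases "0 < f t") (auto simp: mult_nonneg_nonpos)
  qed
  then show ?thesis using \<open>f a \<le> 0\<close> by (simp add: max_def split: if_splits)
qed

text \<open>\<open>f\<close> differs by a constant from the primitive of the continuous function
  \<open>f'\<close>, which is differentiable up to the endpoints. This gives the one-sided
  derivative at the end of a continuously extended solution.\<close>

lemma has_real_derivative_from_continuous_derivative:
  fixes f :: "real \<Rightarrow> real"
  assumes "a < b" and f: "continuous_on {a..b} f" and f': "continuous_on {a..b} f'"
    and der: "\<And>t. t \<in> {a<..<b} \<Longrightarrow> (f has_real_derivative f' t) (at t)" and x: "x \<in> {a..b}"
  shows "(f has_real_derivative f' x) (at x within {a..b})"
proof -
  define g where "g t = integral {a..t} f'" for t
  have g: "(g has_real_derivative f' t) (at t within {a..b})" if "t \<in> {a..b}" for t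
    unfolding g_def by (rule integral_has_real_derivative[OF f' that])
  have eq: "f t - g t = f a - g a" if "t \<in> {a..b}" for t
  proof (rule DERIV_isconst2[of a b "\<lambda>t. f t - g t"])
    show "continuous_on {a..b} (\<lambda>t. f t - g t)"
      by (intro continuous_intros f DERIV_continuous_on[OF g])
    show "((\<lambda>t. f t - g t) has_real_derivative 0) (at x)" if "a < x" "x < b" for x
      using DERIV_diff[OF der[of x] g[of x, unfolded at_within_Icc_at[OF that]]] that by simp
  qed (use that \<open>a < b\<close> in auto)
  have "((\<lambda>t. g t + (f a - g a)) has_real_derivative f' x) (at x within {a..b})"
    using DERIV_add[OF g[OF x] DERIV_const] by simp
  moreover have "g t + (f a - g a) = f t" if "t \<in> {a..b}" for t using eq[OF that] by simp
  ultimately show ?thesis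
    using has_field_derivative_transform_within[of _ "f' x" x "{a..b}" 1 f] x by simp
qed

lemma has_real_derivative_concat:
  fixes f g :: "real \<Rightarrow> real"
  assumes ab: "a \<le> b" "b \<le> c"
    and f: "\<And>t. t \<in> {a..b} \<Longrightarrow> (f has_real_derivative f' t) (at t within {a..b})"
    and g: "\<And>t. t \<in> {b..c} \<Longrightarrow> (g has_real_derivative g' t) (at t within {b..c})"
    and eq: "f b = g b" "f' b = g' b" and t: "t \<in> {a..c}"
  shows "((\<lambda>t. if t \<le> b then f t else g t) has_real_derivative (if t \<le> b then f' t else g' t))
    (at t within {a..c})"
proof -
  have "closure {b<..c} \<subseteq> {b..c}" by (rule closure_minimal) auto
  then have cl: "closure {a..b} \<inter> closure {b<..c} \<subseteq> {b}" by auto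
  have "((\<lambda>x. if x \<in> {a..b} then f x else g x) has_vector_derivative
    (if t \<in> {a..b} then f' t else g' t)) (at t within {a..c})"
  proof (rule has_vector_derivative_If_within_closures[where T = "{b<..c}"])
    show "t \<in> {a..b} \<union> {b<..c}" "{a..c} = {a..b} \<union> {b<..c}" using t ab by auto
    show "(f has_vector_derivative f' t) (at t within {a..b} \<union> closure {a..b} \<inter> closure {b<..c})"
      if "t \<in> {a..b} \<union> closure {a..b} \<inter> closure {b<..c}"
    proof -
      have "{a..b} \<union> closure {a..b} \<inter> closure {b<..c} = {a..b}" using cl ab by auto
      then show ?thesis using f that by (simp add: has_real_derivative_iff_has_vector_derivative)
    qed
    show "(g has_vector_derivative g' t) (at t within {b<..c} \<union> closure {a..b} \<inter> closure {b<..c})"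
      if "t \<in> {b<..c} \<union> closure {a..b} \<inter> closure {b<..c}"
    proof -
      have sub: "{b<..c} \<union> closure {a..b} \<inter> closure {b<..c} \<subseteq> {b..c}" using cl ab by auto
      then have "t \<in> {b..c}" using that by blast
      then have "(g has_vector_derivative g' t) (at t within {b..c})"
        using g by (simp add: has_real_derivative_iff_has_vector_derivative)
      from has_vector_derivative_within_subset[OF this sub] show ?thesis .
    qed
  qed (use cl eq in auto)
  then have "((\<lambda>x. if x \<in> {a..b} then f x else g x) has_real_derivative
    (if t \<in> {a..b} then f' t else g' t)) (at t within {a..c})"
    by (simp add: has_real_derivative_iff_has_vector_derivative)
  moreover have "(if t \<in> {a..b} then f' t else g' t) = (if t \<le> b then f' t else g' t)" using t by auto
  ultimately have "((\<lambda>x. if x \<in> {a..b} then f x else g x) has_real_derivative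
    (if t \<le> b then f' t else g' t)) (at t within {a..c})" by simp
  then show ?thesis
    by (rule has_field_derivative_transform_within[of _ _ _ _ 1]) (use t in auto)
qed

section \<open>Local existence\<close>

lemma Picard_Lipschitz:
  fixes f :: "'a::banach \<Rightarrow> 'a"
  assumes L: "L-lipschitz_on UNIV f"
  obtains \<delta> y where "0 < \<delta>" "y 0 = y0"
    "\<And>t. t \<in> {0..\<delta>} \<Longrightarrow> (y has_vector_derivative f (y t)) (at t within {0..\<delta>})"
proof -
  have L0: "0 \<le> L" using L by (rule lipschitz_on_nonneg)
  \<comment> \<open>Makes the Picard map a contraction with factor 1/2, also when
    \<open>L = 0\<close>.\<close>
  define \<delta> where "\<delta> = 1 / (2 * (L + 1))"
  have \<delta>: "0 < \<delta>" "L * \<delta> \<le> 1 / 2" using L0 by (auto simp: \<delta>_def field_simps)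
  \<comment> \<open>Freezing time outside \<open>{0..\<delta>}\<close> turns Picard iterates into
    bounded continuous functions on the whole line, a complete space.\<close>
  define c where "c t = max 0 (min \<delta> t)" for t
  have c: "c t \<in> {0..\<delta>}" for t using \<delta> by (auto simp: c_def)
  have fcont: "continuous_on S (\<lambda>t. f (\<phi> t))" for S and \<phi> :: "real \<Rightarrow>\<^sub>C 'a"
    using continuous_on_compose2[OF lipschitz_on_continuous_on[OF L], of S "apply_bcontfun \<phi>"] by auto
  define P where "P \<phi> t = y0 + integral {0..c t} (\<lambda>s. f (apply_bcontfun \<phi> s))" for \<phi> t
  have P: "P \<phi> \<in> bcontfun" for \<phi>
  proof -
    have i: "continuous_on {0..\<delta>} (\<lambda>u. y0 + integral {0..u} (\<lambda>s. f (apply_bcontfun \<phi> s)))"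
      by (intro continuous_intros indefinite_integral_continuous_1 integrable_continuous_real fcont)
    have "continuous_on UNIV (P \<phi>)"
      unfolding P_def
      by (rule continuous_on_compose2[OF i, of _ c])
        (use c in \<open>auto simp: c_def[abs_def] intro!: continuous_intros\<close>)
    moreover have "range (P \<phi>) \<subseteq> (\<lambda>u. y0 + integral {0..u} (\<lambda>s. f (apply_bcontfun \<phi> s))) ` {0..\<delta>}"
      using c by (auto simp: P_def)
    then have "bounded (range (P \<phi>))"
      by (rule bounded_subset[rotated]) (intro compact_imp_bounded compact_continuous_image i compact_Icc)
    ultimately show ?thesis by (simp add: bcontfun_def)
  qed
  have "\<exists>!\<phi>. Bcontfun (P \<phi>) = \<phi>"
  proof (rule banach_fix_type[of "1/2"], simp, simp, intro allI dist_bound)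
    fix \<phi> \<psi> t
    have "norm (integral {0..c t} (\<lambda>s. f (apply_bcontfun \<phi> s) - f (apply_bcontfun \<psi> s)))
        \<le> L * dist \<phi> \<psi> * (c t - 0)"
    proof (rule integral_bound)
      show "norm (f (apply_bcontfun \<phi> s) - f (apply_bcontfun \<psi> s)) \<le> L * dist \<phi> \<psi>" for s
        using lipschitz_onD[OF L, of "apply_bcontfun \<phi> s" "apply_bcontfun \<psi> s"]
          mult_left_mono[OF dist_bounded[of \<phi> s \<psi>] L0] by (simp add: dist_norm)
    qed (use c fcont in \<open>auto intro!: continuous_intros\<close>)
    also have "\<dots> \<le> L * dist \<phi> \<psi> * \<delta>"
      using c[of t] L0 by (intro mult_left_mono) auto
    also have "\<dots> = L * \<delta> * dist \<phi> \<psi>" by simp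
    also have "\<dots> \<le> 1 / 2 * dist \<phi> \<psi>"
      by (intro mult_right_mono \<delta>) simp
    finally have "norm (P \<phi> t - P \<psi> t) \<le> 1 / 2 * dist \<phi> \<psi>"
      unfolding P_def by (simp add: integral_diff integrable_continuous_real fcont)
    then show "dist (apply_bcontfun (Bcontfun (P \<phi>)) t) (apply_bcontfun (Bcontfun (P \<psi>)) t) \<le> 1 / 2 * dist \<phi> \<psi>"
      by (simp add: Bcontfun_inverse P dist_norm)
  qed
  then obtain \<phi> where "Bcontfun (P \<phi>) = \<phi>" by blast
  then have \<phi>: "apply_bcontfun \<phi> = P \<phi>" using Bcontfun_inverse[OF P] by metis
  have eq: "apply_bcontfun \<phi> t = y0 + integral {0..t} (\<lambda>s. f (apply_bcontfun \<phi> s))" if "t \<in> {0..\<delta>}" for t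
    using that by (subst \<phi>) (simp add: P_def c_def)
  show ?thesis
  proof (rule that[of \<delta> "apply_bcontfun \<phi>"])
    show "apply_bcontfun \<phi> 0 = y0" using eq[of 0] \<delta> by simp
    fix t assume t: "t \<in> {0..\<delta>}"
    have "((\<lambda>t. y0 + integral {0..t} (\<lambda>s. f (apply_bcontfun \<phi> s))) has_vector_derivative
        0 + f (apply_bcontfun \<phi> t)) (at t within {0..\<delta>})"
      by (intro has_vector_derivative_add has_vector_derivative_const integral_has_vector_derivative fcont t)
    then show "(apply_bcontfun \<phi> has_vector_derivative f (apply_bcontfun \<phi> t)) (at t within {0..\<delta>})"
      using has_vector_derivative_transform[OF t eq] by simp
  qed (rule \<delta>)
qed

lemma lipschitz_on_mult_bounded:
  fixes f g :: "'a::metric_space \<Rightarrow> real"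
  assumes f: "L-lipschitz_on S f" and g: "M-lipschitz_on S g"
    and bf: "\<And>x. x \<in> S \<Longrightarrow> \<bar>f x\<bar> \<le> B" and bg: "\<And>x. x \<in> S \<Longrightarrow> \<bar>g x\<bar> \<le> C" and "0 \<le> B" "0 \<le> C"
  shows "(L * C + B * M)-lipschitz_on S (\<lambda>x. f x * g x)"
proof (rule lipschitz_onI)
  note L0 = lipschitz_on_nonneg[OF f] lipschitz_on_nonneg[OF g]
  show "0 \<le> L * C + B * M" using L0 assms(5,6) by simp
  fix x y assume xy: "x \<in> S" "y \<in> S"
  have "\<bar>f x * g x - f y * g y\<bar> = \<bar>(f x - f y) * g x + f y * (g x - g y)\<bar>" by (simp add: algebra_simps)
  also have "\<dots> \<le> \<bar>f x - f y\<bar> * \<bar>g x\<bar> + \<bar>f y\<bar> * \<bar>g x - g y\<bar>"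
    using abs_triangle_ineq[of "(f x - f y) * g x" "f y * (g x - g y)"] by (simp add: abs_mult)
  also have "\<dots> \<le> (L * dist x y) * C + B * (M * dist x y)"
    using lipschitz_onD[OF f xy] lipschitz_onD[OF g xy] bf[OF xy(2)] bg[OF xy(1)] L0 assms(5,6)
    by (intro add_mono mult_mono) (auto simp: dist_real_def)
  finally show "dist (f x * g x) (f y * g y) \<le> (L * C + B * M) * dist x y"
    by (simp add: dist_real_def algebra_simps)
qed

text \<open>The vector field is not globally Lipschitz, so it is truncated: \<open>k\<close> caps
  the negative part at \<open>V\<close>, and \<open>p\<close> caps the reciprocal at
  \<open>1 / \<epsilon>\<close>. For a short time the solution of the truncated system keeps
  \<open>y\<close> above half of \<open>y0\<close> and \<open>z\<close> within distance 1 of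
  \<open>z0\<close>, where both truncations are inactive.\<close>

lemma local_solution:
  fixes A F y0 z0 :: real
  assumes y0: "0 < y0"
  obtains \<delta> y z where "0 < \<delta>" "y 0 = y0" "z 0 = z0" "\<And>t. t \<in> {0..\<delta>} \<Longrightarrow> 0 < y t"
    "\<And>t. t \<in> {0..\<delta>} \<Longrightarrow> (y has_real_derivative z t) (at t within {0..\<delta>})"
    "\<And>t. t \<in> {0..\<delta>} \<Longrightarrow> (z has_real_derivative A * max 0 (- z t) / y t ^ 3 - F) (at t within {0..\<delta>})"
proof -
  define \<epsilon> where "\<epsilon> = y0 / 2"
  define V where "V = \<bar>z0\<bar> + 1"
  have pos: "0 < \<epsilon>" "0 < V" using y0 by (auto simp: \<epsilon>_def V_def)
  define k where "k z = min V (max 0 (- z))" for z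
  define p where "p y = inverse (max \<epsilon> y)" for y
  define f where "f q = (snd q, A * (k (snd q) * (p (fst q) * (p (fst q) * p (fst q)))) - F)" for q
  have p: "\<bar>p y\<bar> \<le> 1 / \<epsilon>" for y using pos by (auto simp: p_def divide_simps)
  have pL: "(1 / \<epsilon>\<^sup>2)-lipschitz_on UNIV p"
  proof (rule lipschitz_onI)
    fix x y
    have m: "\<epsilon> \<le> max \<epsilon> x" "\<epsilon> \<le> max \<epsilon> y" by auto
    have "inverse u - inverse v = (v - u) / (u * v)" if "0 < u" "0 < v" for u v :: real
      using that by (simp add: field_simps)
    then have "p x - p y = (max \<epsilon> y - max \<epsilon> x) / (max \<epsilon> x * max \<epsilon> y)"
      using pos unfolding p_def by simp
    then have "\<bar>p x - p y\<bar> = \<bar>max \<epsilon> y - max \<epsilon> x\<bar> / (max \<epsilon> x * max \<epsilon> y)"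
      using pos by (simp add: abs_divide abs_mult)
    also have "\<dots> \<le> \<bar>x - y\<bar> / (\<epsilon> * \<epsilon>)"
      using pos m by (intro frac_le mult_mono) auto
    finally show "dist (p x) (p y) \<le> 1 / \<epsilon>\<^sup>2 * dist x y" by (simp add: dist_real_def power2_eq_square)
  qed simp
  have kL: "1-lipschitz_on UNIV k"
    by (rule lipschitz_onI) (auto simp: dist_real_def k_def)
  have k: "\<bar>k z\<bar> \<le> V" for z using pos by (auto simp: k_def)
  have fstL: "1-lipschitz_on UNIV (fst :: real \<times> real \<Rightarrow> real)"
    and sndL: "1-lipschitz_on UNIV (snd :: real \<times> real \<Rightarrow> real)"
    by (rule lipschitz_onI; simp add: dist_fst_le dist_snd_le)+
  have "\<exists>L. L-lipschitz_on UNIV f"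
  proof -
    note p1 = lipschitz_on_compose2[OF fstL lipschitz_on_subset[OF pL subset_UNIV]]
    note k1 = lipschitz_on_compose2[OF sndL lipschitz_on_subset[OF kL subset_UNIV]]
    have b1: "0 \<le> 1 / \<epsilon>" "0 \<le> V" using pos by auto
    have pp: "\<bar>p y * p y\<bar> \<le> 1 / \<epsilon> * (1 / \<epsilon>)" for y
      unfolding abs_mult using p b1 by (intro mult_mono) auto
    have ppp: "\<bar>p y * (p y * p y)\<bar> \<le> 1 / \<epsilon> * (1 / \<epsilon> * (1 / \<epsilon>))" for y
      unfolding abs_mult[of "p y" "p y * p y"] using p b1 pp by (intro mult_mono) auto
    note p2 = lipschitz_on_mult_bounded[OF p1 p1 p p b1(1) b1(1)]
    note p3 = lipschitz_on_mult_bounded[OF p1 p2 p pp b1(1) mult_nonneg_nonneg[OF b1(1) b1(1)]]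
    note kp = lipschitz_on_mult_bounded[OF k1 p3 k ppp b1(2) mult_nonneg_nonneg[OF b1(1) mult_nonneg_nonneg[OF b1(1) b1(1)]]]
    show ?thesis
      unfolding f_def
      using lipschitz_on_Pair[OF sndL lipschitz_on_diff[OF lipschitz_on_cmult_real[OF kp] lipschitz_on_constant]]
      by blast
  qed
  then obtain L where "L-lipschitz_on UNIV f" by blast
  then obtain \<delta> w where \<delta>: "0 < \<delta>" and w0: "w 0 = (y0, z0)"
    and w: "\<And>t. t \<in> {0..\<delta>} \<Longrightarrow> (w has_vector_derivative f (w t)) (at t within {0..\<delta>})"
    by (rule Picard_Lipschitz[where ?y0.0 = "(y0, z0)"]) blast
  define y where "y t = fst (w t)" for t
  define z where "z t = snd (w t)" for t
  have yd: "(y has_real_derivative z t) (at t within {0..\<delta>})" if "t \<in> {0..\<delta>}" for t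
    using bounded_linear.has_vector_derivative[OF bounded_linear_fst w[OF that]]
    by (simp add: has_real_derivative_iff_has_vector_derivative y_def[abs_def] z_def f_def)
  have zd: "(z has_real_derivative A * (k (z t) * (p (y t) * (p (y t) * p (y t)))) - F) (at t within {0..\<delta>})"
    if "t \<in> {0..\<delta>}" for t
    using bounded_linear.has_vector_derivative[OF bounded_linear_snd w[OF that]]
    by (simp add: has_real_derivative_iff_has_vector_derivative y_def z_def[abs_def] f_def)
  have "continuous_on {0..\<delta>} w"
    unfolding continuous_on_eq_continuous_within by (blast intro: has_vector_derivative_continuous w)
  from this[unfolded continuous_on_iff, rule_format, of 0 "min \<epsilon> 1"] obtain d where d: "0 < d"
    "\<And>t. t \<in> {0..\<delta>} \<Longrightarrow> dist t 0 < d \<Longrightarrow> dist (w t) (w 0) < min \<epsilon> 1"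
    using \<delta> pos by auto
  \<comment> \<open>Half of \<open>d\<close>, since continuity was invoked with a strict bound on
    the distance and the interval is closed.\<close>
  define \<delta>' where "\<delta>' = min \<delta> (d / 2)"
  have \<delta>': "0 < \<delta>'" "{0..\<delta>'} \<subseteq> {0..\<delta>}" using \<delta> d by (auto simp: \<delta>'_def)
  have near: "\<epsilon> < y t \<and> \<bar>z t\<bar> < V" if "t \<in> {0..\<delta>'}" for t
  proof -
    have "dist (w t) (w 0) < min \<epsilon> 1"
      by (rule d(2)) (use that d(1) \<delta>' in \<open>auto simp: \<delta>'_def\<close>)
    then have "dist (y t) y0 < \<epsilon>" "dist (z t) z0 < 1"
      using dist_fst_le[of "w t" "w 0"] dist_snd_le[of "w t" "w 0"] by (simp_all add: y_def z_def w0)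
    then show ?thesis unfolding dist_real_def \<epsilon>_def V_def by (intro conjI; argo)
  qed
  show ?thesis
  proof (rule that[of \<delta>' y z])
    fix t assume t: "t \<in> {0..\<delta>'}"
    then have t': "t \<in> {0..\<delta>}" using \<delta>' by auto
    show "0 < y t" using near[OF t] pos by simp
    show "(y has_real_derivative z t) (at t within {0..\<delta>'})"
      by (rule DERIV_subset[OF yd[OF t'] \<delta>'(2)])
    have "A * (k (z t) * (p (y t) * (p (y t) * p (y t)))) = A * max 0 (- z t) / y t ^ 3"
    proof -
      have "k (z t) = max 0 (- z t)" "p (y t) = inverse (y t)"
        using near[OF t] by (auto simp: k_def p_def min_def max_def)
      then show ?thesis by (simp add: power3_eq_cube divide_inverse)
    qed
    then show "(z has_real_derivative A * max 0 (- z t) / y t ^ 3 - F) (at t within {0..\<delta>'})"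
      using DERIV_subset[OF zd[OF t'] \<delta>'(2)] by simp
  qed (use \<delta>' in \<open>auto simp: y_def z_def w0\<close>)
qed

subsection \<open>Trajectories\<close>

text \<open>A scalar equation with \<open>Gfun\<close> in closed form. Maximality is not assumed, so
  the estimates hold for finite \<open>T\<close>, where they yield an extension, as well as for
  infinite \<open>T\<close>.\<close>

locale trajectory =
  fixes A F :: real and T :: ereal and \<eta> v :: "real \<Rightarrow> real"
  assumes A: "0 < A" and F: "0 < F"
    and eta_pos: "0 \<le> t \<Longrightarrow> ereal t < T \<Longrightarrow> 0 < \<eta> t"
    and eta_deriv: "0 \<le> t \<Longrightarrow> ereal t < T \<Longrightarrow>
      (\<eta> has_real_derivative v t) (at t within {s. 0 \<le> s \<and> ereal s < T})"
    and v_deriv: "0 \<le> t \<Longrightarrow> ereal t < T \<Longrightarrow>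
      (v has_real_derivative A * max 0 (- v t) / \<eta> t ^ 3 - F) (at t within {s. 0 \<le> s \<and> ereal s < T})"
begin

lemma on_subinterval:
  assumes "0 \<le> a" "ereal b < T" "t \<in> {a..b}"
  shows "0 < \<eta> t" "(\<eta> has_real_derivative v t) (at t within {a..b})"
    "(v has_real_derivative A * max 0 (- v t) / \<eta> t ^ 3 - F) (at t within {a..b})"
proof -
  have t: "0 \<le> t" "ereal t < T" using assms by (auto intro: le_less_trans[of _ "ereal b"])
  have sub: "{a..b} \<subseteq> {s. 0 \<le> s \<and> ereal s < T}"
    using assms by (auto intro: le_less_trans[of _ "ereal b"])
  show "0 < \<eta> t" by (rule eta_pos[OF t])
  show "(\<eta> has_real_derivative v t) (at t within {a..b})"
    by (rule DERIV_subset[OF eta_deriv[OF t] sub])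
  show "(v has_real_derivative A * max 0 (- v t) / \<eta> t ^ 3 - F) (at t within {a..b})"
    by (rule DERIV_subset[OF v_deriv[OF t] sub])
qed

section \<open>A priori bounds\<close>

text \<open>Where \<open>v\<close> exceeds the barrier it is positive, the damping term vanishes,
  and \<open>v' = - F\<close>.\<close>

lemma v_upper:
  assumes t: "0 \<le> t" "ereal t < T"
  shows "v t \<le> max 0 (v 0)"
proof -
  have "v t - max 0 (v 0) \<le> 0"
  proof (rule nonpos_if_deriv_nonpos_where_pos[OF t(1), where f = "\<lambda>s. v s - max 0 (v 0)"])
    fix s assume s: "s \<in> {0..t}"
    show "((\<lambda>s. v s - max 0 (v 0)) has_real_derivative A * max 0 (- v s) / \<eta> s ^ 3 - F) (at s within {0..t})"
      using DERIV_diff[OF on_subinterval(3)[OF order_refl t(2) s] DERIV_const] by simp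
    show "A * max 0 (- v s) / \<eta> s ^ 3 - F \<le> 0" if "0 < v s - max 0 (v 0)"
      using that F by (simp add: max_def split: if_splits)
  qed simp
  then show ?thesis by simp
qed

text \<open>As long as \<open>\<eta> \<le> M\<close>, a speed \<open>- v\<close> above
  \<open>F * M ^ 3 / A\<close> makes the damping outweigh \<open>F\<close>, so \<open>v\<close>
  cannot fall further.\<close>

lemma v_lower:
  assumes t: "0 \<le> t" "ereal t < T" and M: "0 \<le> M" "\<And>s. s \<in> {0..t} \<Longrightarrow> \<eta> s \<le> M"
  shows "- max (- v 0) (F * M ^ 3 / A) \<le> v t"
proof -
  define m where "m = max (- v 0) (F * M ^ 3 / A)"
  have m: "0 \<le> m" "- v 0 \<le> m" "F * M ^ 3 / A \<le> m" using M(1) F A by (auto simp: m_def le_max_iff_disj)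
  have "- v t - m \<le> 0"
  proof (rule nonpos_if_deriv_nonpos_where_pos[OF t(1), where f = "\<lambda>s. - v s - m"])
    fix s assume s: "s \<in> {0..t}"
    note on = on_subinterval[OF order_refl t(2) s]
    show "((\<lambda>s. - v s - m) has_real_derivative - (A * max 0 (- v s) / \<eta> s ^ 3 - F)) (at s within {0..t})"
      using DERIV_diff[OF DERIV_minus[OF on(3)] DERIV_const] by simp
    assume gt: "0 < - v s - m"
    have "F * \<eta> s ^ 3 \<le> F * M ^ 3"
      using F M(2)[OF s] on(1) by (intro mult_left_mono power_mono) auto
    also have "\<dots> \<le> A * m" using m(3) A by (simp add: field_simps)
    also have "\<dots> \<le> A * max 0 (- v s)" using gt A by (intro mult_left_mono) auto
    finally show "- (A * max 0 (- v s) / \<eta> s ^ 3 - F) \<le> 0"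
      using on(1) by (simp add: pos_le_divide_eq)
  qed (use m in simp)
  then show ?thesis by (simp add: m_def)
qed

text \<open>While \<open>v\<close> is positive it decreases at the exact rate \<open>F\<close>; this
  is the time it then needs to reach 0.\<close>

definition \<tau> :: real where "\<tau> = max 0 (v 0) / F"

lemma tau_nonneg: "0 \<le> \<tau>"
  using F by (simp add: \<tau>_def)

text \<open>Once nonpositive, \<open>v\<close> stays so, as \<open>v' = - F\<close> wherever
  \<open>v > 0\<close>. Were it positive on all of \<open>{0..t}\<close>, then
  \<open>v t \<le> v 0 - F * t\<close>, which is nonpositive after \<open>\<tau>\<close>.\<close>

lemma v_nonpos:
  assumes t: "\<tau> \<le> t" "ereal t < T"
  shows "v t \<le> 0"
proof (cases "\<exists>s\<in>{0..t}. v s \<le> 0")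
  case True
  then obtain s where s: "s \<in> {0..t}" "v s \<le> 0" by blast
  show ?thesis
  proof (rule nonpos_if_deriv_nonpos_where_pos[of s t v, OF _ on_subinterval(3)[OF _ t(2)] _ s(2)])
    show "A * max 0 (- v r) / \<eta> r ^ 3 - F \<le> 0" if "0 < v r" for r using that F by simp
  qed (use s in auto)
next
  case False
  then have pos: "\<And>s. s \<in> {0..t} \<Longrightarrow> 0 < v s" by force
  have "0 \<le> t" using t tau_nonneg by simp
  have "v t + F * t \<le> v 0 + F * 0"
  proof (rule nonincreasing_if_deriv_nonpos[OF \<open>0 \<le> t\<close>, where f = "\<lambda>s. v s + F * s"])
    fix s assume s: "s \<in> {0..t}"
    show "((\<lambda>s. v s + F * s) has_real_derivative (A * max 0 (- v s) / \<eta> s ^ 3 - F) + F) (at s within {0..t})"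
      by (intro DERIV_add on_subinterval[OF order_refl t(2) s]) (auto intro!: derivative_eq_intros)
    show "(A * max 0 (- v s) / \<eta> s ^ 3 - F) + F \<le> 0" using pos[OF s] by simp
  qed
  moreover have "v 0 \<le> F * t"
    using t(1) F unfolding \<tau>_def by (simp add: pos_divide_le_eq mult.commute)
  ultimately show ?thesis by simp
qed

text \<open>Growth at rate at most \<open>max 0 (v 0)\<close> is possible only up to
  \<open>\<tau>\<close>; afterwards \<open>\<eta>\<close> is nonincreasing.\<close>

lemma eta_upper:
  assumes t: "0 \<le> t" "ereal t < T"
  shows "\<eta> t \<le> \<eta> 0 + max 0 (v 0) * \<tau>"
proof -
  have 1: "\<eta> s \<le> \<eta> 0 + max 0 (v 0) * s" if s: "0 \<le> s" "ereal s < T" for s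
  proof -
    have "\<eta> s - max 0 (v 0) * s \<le> \<eta> 0 - max 0 (v 0) * 0"
    proof (rule nonincreasing_if_deriv_nonpos[OF s(1), where f = "\<lambda>s. \<eta> s - max 0 (v 0) * s"])
      fix r assume r: "r \<in> {0..s}"
      show "((\<lambda>s. \<eta> s - max 0 (v 0) * s) has_real_derivative v r - max 0 (v 0)) (at r within {0..s})"
        by (intro DERIV_diff on_subinterval[OF order_refl s(2) r]) (auto intro!: derivative_eq_intros)
      have "ereal r < T" using r s(2) by (auto intro: le_less_trans[of _ "ereal s"])
      then show "v r - max 0 (v 0) \<le> 0" using v_upper[of r] r by simp
    qed
    then show ?thesis by simp
  qed
  show ?thesis
  proof (cases "t \<le> \<tau>")
    case True
    then have "max 0 (v 0) * t \<le> max 0 (v 0) * \<tau>" by (intro mult_left_mono) auto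
    then show ?thesis using 1[OF t] by simp
  next
    case False
    then have \<tau>: "ereal \<tau> < T" "\<tau> \<le> t" using t(2) by (auto intro: le_less_trans[of _ "ereal t"])
    have "\<eta> t \<le> \<eta> \<tau>"
    proof (rule nonincreasing_if_deriv_nonpos[OF \<tau>(2) on_subinterval(2)[OF tau_nonneg t(2)]])
      fix r assume r: "r \<in> {\<tau>..t}"
      then have "ereal r < T" using t(2) by (auto intro: le_less_trans[of _ "ereal t"])
      then show "v r \<le> 0" using v_nonpos r by simp
    qed
    then show ?thesis using 1[OF tau_nonneg \<tau>(1)] by simp
  qed
qed

text \<open>On stretches where \<open>v \<le> 0\<close> the equation reads \<open>v' = (A / (2 \<eta>\<^sup>2))' - F\<close>,
  which makes this quantity a first integral; where \<open>v > 0\<close> it increases.\<close>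
definition \<Phi> :: "real \<Rightarrow> real" where
  "\<Phi> t = v t - A / (2 * (\<eta> t)\<^sup>2) + F * t"

lemma \<Phi>_deriv:
  assumes "0 \<le> a" "ereal b < T" "t \<in> {a..b}"
  shows "(\<Phi> has_real_derivative A * max 0 (v t) / \<eta> t ^ 3) (at t within {a..b})"
proof -
  note on = on_subinterval[OF assms]
  have "((\<lambda>t. v t - A / (2 * (\<eta> t)\<^sup>2) + F * t) has_real_derivative
      (A * max 0 (- v t) / \<eta> t ^ 3 - F) + A * v t / \<eta> t ^ 3 + F) (at t within {a..b})"
    using on(1) by (auto intro!: derivative_eq_intros on(2,3) simp: field_simps power2_eq_square power3_eq_cube)
  \<comment> \<open>The positive and negative parts combine:
    \<open>max 0 (- v) + v = max 0 v\<close>.\<close>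
  moreover have "(A * max 0 (- v t) / \<eta> t ^ 3 - F) + A * v t / \<eta> t ^ 3 + F = A * max 0 (v t) / \<eta> t ^ 3"
    by (simp add: max_def)
  ultimately show ?thesis unfolding \<Phi>_def[abs_def] by simp
qed

lemma \<Phi>_ge_initial:
  assumes t: "0 \<le> t" "ereal t < T"
  shows "\<Phi> 0 \<le> \<Phi> t"
proof -
  have "- \<Phi> t \<le> - \<Phi> 0"
    using A on_subinterval(1)[OF order_refl t(2)]
    by (intro nonincreasing_if_deriv_nonpos[OF t(1) DERIV_minus[OF \<Phi>_deriv[OF order_refl t(2)]]]) (auto simp: zero_le_divide_iff zero_le_mult_iff less_imp_le)
  then show ?thesis by simp
qed

text \<open>An upper bound on \<open>\<Phi>\<close> forces \<open>A / (2 * \<eta>\<^sup>2)\<close>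
  to grow, hence decay of \<open>\<eta>\<close>; \<open>\<Phi>_ge_initial\<close> limits that growth
  and keeps \<open>\<eta>\<close> away from 0 on bounded times.\<close>

lemma \<Phi>_le_late:
  assumes t: "\<tau> \<le> t" "ereal t < T"
  shows "\<Phi> t \<le> \<Phi> \<tau>"
proof (rule nonincreasing_if_deriv_nonpos[OF t(1) \<Phi>_deriv[OF tau_nonneg t(2)]])
  fix r assume r: "r \<in> {\<tau>..t}"
  then have "ereal r < T" using t(2) by (auto intro: le_less_trans[of _ "ereal t"])
  then have "v r \<le> 0" using v_nonpos r by simp
  then show "A * max 0 (v r) / \<eta> r ^ 3 \<le> 0" by (simp add: max_def)
qed

text \<open>The shift \<open>b\<close> absorbs the constants:
  \<open>A / (2 * \<eta>\<^sup>2) = v + F * t - \<Phi>\<close> is at most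
  \<open>F * (t + b)\<close>. Solving for \<open>\<eta>\<close> gives the factor
  \<open>sqrt (A / (2 * F))\<close>.\<close>

lemma eta_lower_sqrt:
  assumes t: "0 \<le> t" "ereal t < T" and B: "max 0 (v 0) - \<Phi> 0 \<le> F * b" "0 < t + b"
  shows "sqrt (A / (2 * F)) / sqrt (t + b) \<le> \<eta> t"
proof -
  have pos: "0 < \<eta> t" using eta_pos t by simp
  have "A / (2 * (\<eta> t)\<^sup>2) \<le> F * (t + b)"
    using \<Phi>_ge_initial[OF t] v_upper[OF t] B(1)
    unfolding \<Phi>_def[of t] distrib_left by linarith
  then have "A \<le> (\<eta> t)\<^sup>2 * (2 * F * (t + b))"
    using pos by (simp add: pos_divide_le_eq algebra_simps)
  then have "A / (2 * F * (t + b)) \<le> (\<eta> t)\<^sup>2"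
    using F B(2) by (simp add: pos_divide_le_eq)
  then have "A / (2 * F) / (t + b) \<le> (\<eta> t)\<^sup>2" by simp
  then have "sqrt (A / (2 * F) / (t + b)) \<le> sqrt ((\<eta> t)\<^sup>2)" by (rule real_sqrt_le_mono)
  then show ?thesis using pos by (simp add: real_sqrt_divide real_sqrt_mult)
qed

lemma eta_to_0:
  assumes "T = \<infinity>"
  shows "(\<eta> \<longlongrightarrow> 0) at_top"
proof -
  define M where "M = \<eta> 0 + max 0 (v 0) * \<tau>"
  define m where "m = max (- v 0) (F * M ^ 3 / A)"
  have M: "0 \<le> M" using eta_pos[of 0] assms tau_nonneg by (simp add: M_def)
  have vm: "- m \<le> v t" if "0 \<le> t" for t
    unfolding m_def by (rule v_lower[OF that _ M]) (use assms eta_upper M_def in auto)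
  have "eventually (\<lambda>t. dist (\<eta> t) 0 < e) at_top" if "e > 0" for e
  proof -
    \<comment> \<open>Beyond this time \<open>F * t - m - \<Phi> \<tau>\<close>, a lower bound for
      \<open>A / (2 * \<eta>\<^sup>2)\<close>, exceeds \<open>A / (2 * e\<^sup>2)\<close>.\<close>
    define t1 where "t1 = max \<tau> ((\<Phi> \<tau> + m + A / (2 * e\<^sup>2)) / F)"
    have "dist (\<eta> t) 0 < e" if "t > t1" for t
    proof (rule ccontr)
      have t: "\<tau> < t" "(\<Phi> \<tau> + m + A / (2 * e\<^sup>2)) / F < t" "0 \<le> t"
        using that tau_nonneg by (auto simp: t1_def)
      assume "\<not> dist (\<eta> t) 0 < e"
      then have "e \<le> \<eta> t" using eta_pos[of t] t assms by (simp add: dist_real_def)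
      then have "A / (2 * (\<eta> t)\<^sup>2) \<le> A / (2 * e\<^sup>2)"
        using A \<open>e > 0\<close> by (intro divide_left_mono mult_left_mono power_mono) auto
      moreover have "\<Phi> t \<le> \<Phi> \<tau>" using \<Phi>_le_late t assms by simp
      moreover have "\<Phi> \<tau> + m + A / (2 * e\<^sup>2) < F * t" using t(2) F by (simp add: pos_divide_less_eq mult.commute)
      ultimately show False using vm[OF t(3)] unfolding \<Phi>_def[of t] by linarith
    qed
    then show ?thesis using eventually_gt_at_top[of t1] by (rule eventually_mono[rotated])
  qed
  then show ?thesis by (intro tendstoI)
qed

section \<open>Continuation past a finite time\<close>

text \<open>On a bounded interval \<open>\<eta>\<close> stays above some \<open>\<mu> > 0\<close>
  and \<open>v\<close> is bounded, so both derivatives are bounded. Thus \<open>\<eta>\<close> and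
  \<open>v\<close> are Lipschitz, have limits at \<open>b\<close>, and the equation can be restarted
  from these.\<close>

lemma extendable:
  assumes "0 < b" "T = ereal b"
  obtains c \<zeta> w where "b < c" "\<And>t. 0 \<le> t \<Longrightarrow> t < b \<Longrightarrow> \<zeta> t = \<eta> t" "\<And>t. 0 \<le> t \<Longrightarrow> t < b \<Longrightarrow> w t = v t"
    "\<And>t. t \<in> {0..c} \<Longrightarrow> 0 < \<zeta> t"
    "\<And>t. t \<in> {0..c} \<Longrightarrow> (\<zeta> has_real_derivative w t) (at t within {0..c})"
    "\<And>t. t \<in> {0..c} \<Longrightarrow> (w has_real_derivative A * max 0 (- w t) / \<zeta> t ^ 3 - F) (at t within {0..c})"
proof -
  define M where "M = \<eta> 0 + max 0 (v 0) * \<tau>"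
  define N where "N = max (max 0 (v 0)) (max (- v 0) (F * M ^ 3 / A))"
  have M: "0 \<le> M" using eta_pos[of 0] assms tau_nonneg by (simp add: M_def)
  have vN: "\<bar>v t\<bar> \<le> N" if "0 \<le> t" "t < b" for t
  proof -
    have "- max (- v 0) (F * M ^ 3 / A) \<le> v t"
      by (rule v_lower[OF that(1) _ M]) (use assms that eta_upper M_def in auto)
    moreover have "v t \<le> max 0 (v 0)" using v_upper that assms by simp
    ultimately show ?thesis unfolding N_def by linarith
  qed
  \<comment> \<open>The \<open>max 1\<close> makes \<open>C\<close> positive, so that
    \<open>t + C > 0\<close> already at \<open>t = 0\<close>.\<close>
  define C where "C = max 1 (max 0 (v 0) - \<Phi> 0) / F"
  have C: "max 0 (v 0) - \<Phi> 0 \<le> F * C" "0 < C" using F by (auto simp: C_def)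
  define \<mu> where "\<mu> = sqrt (A / (2 * F)) / sqrt (b + C)"
  have \<mu>: "0 < \<mu>" using A F C assms by (simp add: \<mu>_def)
  have low: "\<mu> \<le> \<eta> t" if "0 \<le> t" "t < b" for t
  proof -
    have "\<mu> \<le> sqrt (A / (2 * F)) / sqrt (t + C)"
      unfolding \<mu>_def using that C A F by (intro divide_left_mono) auto
    also have "\<dots> \<le> \<eta> t" using that C assms by (intro eta_lower_sqrt) auto
    finally show ?thesis .
  qed
  have I: "{s. 0 \<le> s \<and> ereal s < T} = {0..<b}" using assms by auto
  have lip: "\<exists>g. K-lipschitz_on {0..b} g \<and> (\<forall>t\<in>{0..<b}. g t = f t)"
    if "\<And>t. t \<in> {0..<b} \<Longrightarrow> (f has_real_derivative f' t) (at t within {0..<b})"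
      "\<And>t. t \<in> {0..<b} \<Longrightarrow> \<bar>f' t\<bar> \<le> K" for f f' K
  proof -
    have "0 \<le> K" using that(2)[of 0] assms(1) by auto
    then have "K-lipschitz_on {0..<b} f"
      by (intro lipschitz_onI) (use field_differentiable_bound[of "{0..<b}" f f' K] that in \<open>auto simp: dist_norm\<close>)
    from lipschitz_extend_closure[OF this] show ?thesis using assms(1) by simp
  qed
  have "\<exists>g. N-lipschitz_on {0..b} g \<and> (\<forall>t\<in>{0..<b}. g t = \<eta> t)"
    by (rule lip[of \<eta> v]) (use eta_deriv vN I assms in auto)
  then obtain y where y: "N-lipschitz_on {0..b} y" "\<And>t. t \<in> {0..<b} \<Longrightarrow> y t = \<eta> t" by blast
  have "\<exists>g. (A * N / \<mu> ^ 3 + F)-lipschitz_on {0..b} g \<and> (\<forall>t\<in>{0..<b}. g t = v t)"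
  proof (rule lip[of v "\<lambda>t. A * max 0 (- v t) / \<eta> t ^ 3 - F"])
    fix t assume t: "t \<in> {0..<b}"
    show "(v has_real_derivative A * max 0 (- v t) / \<eta> t ^ 3 - F) (at t within {0..<b})"
      using v_deriv[of t] t assms I by simp
    have "A * max 0 (- v t) / \<eta> t ^ 3 \<le> A * N / \<mu> ^ 3"
      using t vN[of t] low[of t] \<mu> A by (intro frac_le mult_left_mono power_mono) auto
    moreover have "0 \<le> A * max 0 (- v t) / \<eta> t ^ 3" using t low[of t] \<mu> A by (auto intro!: divide_nonneg_nonneg)
    ultimately show "\<bar>A * max 0 (- v t) / \<eta> t ^ 3 - F\<bar> \<le> A * N / \<mu> ^ 3 + F" using F by linarith
  qed
  then obtain z where z: "(A * N / \<mu> ^ 3 + F)-lipschitz_on {0..b} z" "\<And>t. t \<in> {0..<b} \<Longrightarrow> z t = v t" by blast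
  note yc = lipschitz_on_continuous_on[OF y(1)] and zc = lipschitz_on_continuous_on[OF z(1)]
  have y\<mu>: "\<mu> \<le> y t" if "t \<in> {0..b}" for t
  proof -
    have "closure {0..<b} = {0..b}" using assms(1) by simp
    then show ?thesis
      using continuous_ge_on_closure[of "{0..<b}" y t \<mu>] yc that y(2) low by auto
  qed
  have int: "(f has_real_derivative D) (at t)"
    if "(g has_real_derivative D) (at t within {0..<b})" "t \<in> {0<..<b}" "\<And>t. t \<in> {0..<b} \<Longrightarrow> f t = g t" for f g D t
  proof -
    have "(g has_real_derivative D) (at t within {0<..<b})" by (rule DERIV_subset[OF that(1)]) auto
    then have "(g has_real_derivative D) (at t)" using that(2) at_within_open[of t "{0<..<b}"] by simp
    then show ?thesis
      by (rule has_field_derivative_transform_within_open[of _ _ _ "{0<..<b}"]) (use that in auto)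
  qed
  \<comment> \<open>In the interior this is the given equation; at the endpoints it follows from
    continuity of the derivative.\<close>
  have yd: "(y has_real_derivative z t) (at t within {0..b})" if t: "t \<in> {0..b}" for t
  proof (rule has_real_derivative_from_continuous_derivative[OF assms(1) yc zc _ t])
    show "(y has_real_derivative z t) (at t)" if "t \<in> {0<..<b}" for t
      using int[OF _ that, of \<eta> "v t" y] that eta_deriv[of t] I assms y(2) z(2)[of t] by simp
  qed
  have zd: "(z has_real_derivative A * max 0 (- z t) / y t ^ 3 - F) (at t within {0..b})" if t: "t \<in> {0..b}" for t
  proof (rule has_real_derivative_from_continuous_derivative[OF assms(1) zc _ _ t])
    show "continuous_on {0..b} (\<lambda>t. A * max 0 (- z t) / y t ^ 3 - F)"
      using y\<mu> \<mu> by (intro continuous_intros yc zc) fastforce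
    show "(z has_real_derivative A * max 0 (- z t) / y t ^ 3 - F) (at t)" if "t \<in> {0<..<b}" for t
      using int[OF _ that, of v "A * max 0 (- v t) / \<eta> t ^ 3 - F" z] that v_deriv[of t] I assms y(2)[of t] z(2) by simp
  qed
  \<comment> \<open>The bound \<open>\<mu>\<close> survives the passage to the closure, so the
    restart begins inside the region where the equation is regular.\<close>
  have "0 < y b" using y\<mu>[of b] \<mu> assms(1) by simp
  then obtain \<delta> p q where \<delta>: "0 < \<delta>" and pq0: "p 0 = y b" "q 0 = z b"
    and p_pos: "\<And>t. t \<in> {0..\<delta>} \<Longrightarrow> 0 < p t"
    and p: "\<And>t. t \<in> {0..\<delta>} \<Longrightarrow> (p has_real_derivative q t) (at t within {0..\<delta>})"
    and q: "\<And>t. t \<in> {0..\<delta>} \<Longrightarrow> (q has_real_derivative A * max 0 (- q t) / p t ^ 3 - F) (at t within {0..\<delta>})"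
    by (rule local_solution[where ?z0.0 = "z b" and A = A and F = F]) blast
  have shift: "((\<lambda>t. f (t - b)) has_real_derivative D) (at t within {b..b + \<delta>})"
    if "(f has_real_derivative D) (at (t - b) within {0..\<delta>})" for f D t
  proof -
    have "(\<lambda>t. t - b) ` {b..b + \<delta>} = {0..\<delta>}"
      using image_add_atLeastAtMost[of "- b" b "b + \<delta>"] by (simp add: algebra_simps)
    then have "((f \<circ> (\<lambda>t. t - b)) has_real_derivative D * 1) (at t within {b..b + \<delta>})"
      using that by (intro DERIV_image_chain) (auto intro!: derivative_eq_intros)
    then show ?thesis by (simp add: o_def)
  qed
  show ?thesis
  proof (rule that[of "b + \<delta>" "\<lambda>t. if t \<le> b then y t else p (t - b)" "\<lambda>t. if t \<le> b then z t else q (t - b)"])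
    fix t assume t: "t \<in> {0..b + \<delta>}"
    show "0 < (if t \<le> b then y t else p (t - b))"
      using y\<mu>[of t] \<mu> p_pos[of "t - b"] t by auto
    show "((\<lambda>t. if t \<le> b then y t else p (t - b)) has_real_derivative (if t \<le> b then z t else q (t - b)))
        (at t within {0..b + \<delta>})"
      by (rule has_real_derivative_concat) (use assms(1) \<delta> t pq0 in \<open>auto intro!: yd shift p\<close>)
    have "((\<lambda>t. if t \<le> b then z t else q (t - b)) has_real_derivative
        (if t \<le> b then A * max 0 (- z t) / y t ^ 3 - F else A * max 0 (- q (t - b)) / p (t - b) ^ 3 - F))
        (at t within {0..b + \<delta>})"
      by (rule has_real_derivative_concat) (use assms(1) \<delta> t pq0 in \<open>auto intro!: zd shift q\<close>)
    then show "((\<lambda>t. if t \<le> b then z t else q (t - b)) has_real_derivative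
        A * max 0 (- (if t \<le> b then z t else q (t - b))) / (if t \<le> b then y t else p (t - b)) ^ 3 - F)
        (at t within {0..b + \<delta>})"
      by (simp split: if_splits)
  qed (use \<delta> y z in auto)
qed

end

theorem theorem2p4:
  fixes \<Omega> :: "(real ^ 2) set" and F \<eta>0 \<eta>1 :: real and T :: ereal and \<eta> d\<eta> :: "real \<Rightarrow> real"
  assumes "open \<Omega>" and "bounded \<Omega>" and "regular_boundary \<Omega>" and "0 \<in> \<Omega>"
    and "F > 0" and "\<eta>0 > 0"
    and "maximal_ode_sol (Gfun \<Omega> F) \<eta>0 \<eta>1 T \<eta> d\<eta>"
  shows "T = \<infinity> \<and>
    (\<exists>M0>0. \<exists>M1>0. \<forall>t\<ge>0. 0 < \<eta> t \<and> \<eta> t \<le> M0 \<and> \<bar>d\<eta> t\<bar> \<le> M1) \<and>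
    (\<eta> \<longlongrightarrow> 0) at_top \<and>
    (\<exists>t0\<ge>0. \<exists>a>0. \<exists>b. t0 + b > 0 \<and> (\<forall>t\<ge>t0. \<eta> t \<ge> a / sqrt (t + b))) \<and>
    \<not> (\<exists>\<eta>b>0. Gfun \<Omega> F \<eta>b 0 = 0)"
proof -
  interpret bounded_domain \<Omega>
    by standard (rule assms)+
  obtain A where A: "0 < A"
    and G: "\<And>F \<beta> \<gamma>. 0 < \<beta> \<Longrightarrow> Gfun \<Omega> F \<beta> \<gamma> = A * max 0 (- \<gamma>) / \<beta> ^ 3 - F"
    by (rule Gfun_formula) (use assms(4) in auto)
  have sol: "ode_sol (Gfun \<Omega> F) \<eta>0 \<eta>1 T \<eta> d\<eta>"
    and max: "\<And>T' \<zeta> w. T < T' \<Longrightarrow> ode_sol (Gfun \<Omega> F) \<eta>0 \<eta>1 T' \<zeta> w \<Longrightarrow>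
      \<not> (\<forall>t. 0 \<le> t \<and> ereal t < T \<longrightarrow> \<zeta> t = \<eta> t)"
    using assms(7) unfolding maximal_ode_sol_def by blast+
  have T: "0 < T" and init: "\<eta> 0 = \<eta>0" "d\<eta> 0 = \<eta>1" using sol by (auto simp: ode_sol_def)
  interpret trajectory A F T \<eta> d\<eta>
  proof
    fix t assume t: "0 \<le> t" "ereal t < T"
    then show pos: "0 < \<eta> t"
      and "(\<eta> has_real_derivative d\<eta> t) (at t within {s. 0 \<le> s \<and> ereal s < T})"
      using sol by (auto simp: ode_sol_def)
    have "(d\<eta> has_real_derivative Gfun \<Omega> F (\<eta> t) (d\<eta> t)) (at t within {s. 0 \<le> s \<and> ereal s < T})"
      using sol t by (auto simp: ode_sol_def)
    then show "(d\<eta> has_real_derivative A * max 0 (- d\<eta> t) / \<eta> t ^ 3 - F) (at t within {s. 0 \<le> s \<and> ereal s < T})"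
      by (simp add: G[OF pos])
  qed (use A assms in auto)
  have "T = \<infinity>"
  proof (rule ccontr)
    assume "T \<noteq> \<infinity>"
    with T obtain b where b: "0 < b" "T = ereal b" by (cases T) auto
    obtain c \<zeta> w where c: "b < c" and \<zeta>: "\<And>t. 0 \<le> t \<Longrightarrow> t < b \<Longrightarrow> \<zeta> t = \<eta> t"
      and w: "\<And>t. 0 \<le> t \<Longrightarrow> t < b \<Longrightarrow> w t = d\<eta> t"
      and pos: "\<And>t. t \<in> {0..c} \<Longrightarrow> 0 < \<zeta> t"
      and \<zeta>d: "\<And>t. t \<in> {0..c} \<Longrightarrow> (\<zeta> has_real_derivative w t) (at t within {0..c})"
      and wd: "\<And>t. t \<in> {0..c} \<Longrightarrow> (w has_real_derivative A * max 0 (- w t) / \<zeta> t ^ 3 - F) (at t within {0..c})"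
      by (rule extendable[OF b]) blast
    \<comment> \<open>The half-open interval up to \<open>c\<close> strictly contains the one up to
      \<open>b\<close>, and the two solutions agree on the latter, against maximality.\<close>
    have "ode_sol (Gfun \<Omega> F) \<eta>0 \<eta>1 (ereal c) \<zeta> w"
      unfolding ode_sol_def
    proof (intro conjI allI impI)
      show "0 < ereal c" "\<zeta> 0 = \<eta>0" "w 0 = \<eta>1" using b c init \<zeta> w by auto
      fix t assume "0 \<le> t \<and> ereal t < ereal c"
      then have t: "t \<in> {0..c}" by simp
      have sub: "{s. 0 \<le> s \<and> ereal s < ereal c} \<subseteq> {0..c}" by auto
      show "0 < \<zeta> t" by (rule pos[OF t])
      show "(\<zeta> has_real_derivative w t) (at t within {s. 0 \<le> s \<and> ereal s < ereal c})"
        by (rule DERIV_subset[OF \<zeta>d[OF t] sub])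
      show "(w has_real_derivative Gfun \<Omega> F (\<zeta> t) (w t)) (at t within {s. 0 \<le> s \<and> ereal s < ereal c})"
        unfolding G[OF pos[OF t]] by (rule DERIV_subset[OF wd[OF t] sub])
    qed
    then show False using max[of "ereal c" \<zeta> w] b c \<zeta> by auto
  qed
  have lt: "ereal t < T" for t using \<open>T = \<infinity>\<close> by simp
  define M0 where "M0 = \<eta> 0 + max 0 (d\<eta> 0) * \<tau>"
  define M1 where "M1 = max (max 0 (d\<eta> 0)) (max (- d\<eta> 0) (F * M0 ^ 3 / A))"
  have M0: "0 < M0" using init assms(6) tau_nonneg by (simp add: M0_def add_pos_nonneg)
  have up: "\<eta> t \<le> M0" if "0 \<le> t" for t
    using eta_upper[OF that lt] by (simp add: M0_def)
  have M1: "\<bar>d\<eta> t\<bar> \<le> M1" if "0 \<le> t" for t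
  proof -
    have "- max (- d\<eta> 0) (F * M0 ^ 3 / A) \<le> d\<eta> t"
      by (rule v_lower[OF that lt]) (use M0 up in auto)
    then show ?thesis using v_upper[OF that lt] unfolding M1_def by linarith
  qed
  have "0 < F * M0 ^ 3 / A" using M0 A assms(5) by simp
  then have "0 < M1" by (simp add: M1_def less_max_iff_disj)
  \<comment> \<open>As for the extension, \<open>max 1\<close> ensures \<open>b > 0\<close>; hence
    the square-root bound holds from \<open>t0 = 0\<close> on.\<close>
  define b where "b = max 1 (max 0 (d\<eta> 0) - \<Phi> 0) / F"
  have b: "max 0 (d\<eta> 0) - \<Phi> 0 \<le> F * b" "0 < b" using assms(5) by (auto simp: b_def)
  have "\<eta> t \<ge> sqrt (A / (2 * F)) / sqrt (t + b)" if "0 \<le> t" for t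
    by (rule eta_lower_sqrt[OF that lt b(1)]) (use that b in simp)
  moreover have "0 < sqrt (A / (2 * F))" using A assms(5) by simp
  ultimately have "\<exists>t0\<ge>0. \<exists>a>0. \<exists>b. t0 + b > 0 \<and> (\<forall>t\<ge>t0. \<eta> t \<ge> a / sqrt (t + b))"
    using b(2) by (intro exI[of _ 0] exI[of _ "sqrt (A / (2 * F))"] exI[of _ b] conjI) auto
  moreover have "\<exists>M0>0. \<exists>M1>0. \<forall>t\<ge>0. 0 < \<eta> t \<and> \<eta> t \<le> M0 \<and> \<bar>d\<eta> t\<bar> \<le> M1"
    using M0 \<open>0 < M1\<close> up M1 eta_pos[OF _ lt] by blast
  moreover have "\<not> (\<exists>\<eta>b>0. Gfun \<Omega> F \<eta>b 0 = 0)"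
    using G[of _ F 0] assms(5) by auto
  ultimately show ?thesis using \<open>T = \<infinity>\<close> eta_to_0 by blast
qed

end
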